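(* Let $\mathsf X$ be a 45-closed subset of $\{\mathsf d,\mathsf t,\mathsf b,\mathsf 4,\mathsf 5\}$. For every nested sequent $\Gamma$: if $\mathsf K+\Diamond\mathsf X_{\mathsf c}+\mathsf{cut}\vdash\Gamma$ then $\mathsf K+\Diamond\mathsf X_{\mathsf c}\vdash\Gamma$.
   Context: Formulas: $A::=p\mid\bar p\mid A\vee A\mid A\wedge A\mid\Diamond A\mid\Box A$, $\bar A$ by De Morgan laws. A nested sequent is a finite multiset of formulas and boxed sequents $[\Delta]$. Contexts $\Gamma\{\ \}$ (one hole, not inside formulas), filling $\Gamma\{\Delta\}$, binary contexts $\Gamma\{\ \}\{\ \}$, depth of $\Gamma\{\ \}\{\emptyset\}$ = number of boxes enclosing the first hole. Rules (premises / conclusion): axiom $\Gamma\{p,\bar p\}$; $\wedge$: $\Gamma\{A\},\Gamma\{B\}/\Gamma\{A\wedge B\}$; $\vee$: $\Gamma\{A,B\}/\Gamma\{A\vee B\}$; $\Box$: $\Gamma\{[A]\}/\Gamma\{\Box A\}$; $\Diamond\mathsf k_{\mathsf c}$: $\Gamma\{\Diamond A,[\Delta,A]\}/\Gamma\{\Diamond A,[\Delta]\}$; $\Diamond\mathsf d_{\mathsf c}$: $\Gamma\{\Diamond A,[A]\}/\Gamma\{\Diamond A\}$; $\Diamond\mathsf t_{\mathsf c}$: $\Gamma\{\Diamond A,A\}/\Gamma\{\Diamond A\}$; $\Diamond\mathsf b_{\mathsf c}$: $\Gamma\{[\Delta,\Diamond A],A\}/\Gamma\{[\Delta,\Diamond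 A]\}$; $\Diamond\mathsf 4_{\mathsf c}$: $\Gamma\{\Diamond A,[\Delta,\Diamond A]\}/\Gamma\{\Diamond A,[\Delta]\}$; $\Diamond\mathsf 5_{\mathsf c}$: $\Gamma\{\Diamond A\}\{\Diamond A\}/\Gamma\{\Diamond A\}\{\emptyset\}$ if depth of $\Gamma\{\ \}\{\emptyset\}>0$; $\mathsf{cut}$: $\Gamma\{A\},\Gamma\{\bar A\}/\Gamma\{\emptyset\}$. $\mathsf K=\{\wedge,\vee,\Box,\Diamond\mathsf k_{\mathsf c}\}$ with the axiom; $\mathsf K+\Diamond\mathsf X_{\mathsf c}$ adds $\Diamond\rho_{\mathsf c}$ for $\rho\in\mathsf X$. $\vdash$ denotes provability by finite trees whose leaves are axioms. $\mathsf X$ is 45-closed if for each $\rho\in\{\mathsf 4,\mathsf 5\}$: if every Kripke frame satisfying the frame conditions of $\mathsf X$ ($\mathsf d$ serial, $\mathsf t$ reflexive, $\mathsf b$ symmetric, $\mathsf 4$ transitive, $\mathsf 5$ euclidean) also satisfies the condition of $\rho$, then $\rho\in\mathsf X$. *)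

theory Defs
  imports "HOL-Library.Multiset" "HOL-Library.Countable_Set"
begin

section \<open>Formulas and nested sequents\<close>

datatype 'a fm =
    Atom 'a
  | NAtom 'a
  | Or "'a fm" "'a fm"
  | And "'a fm" "'a fm"
  | Dia "'a fm"
  | Box "'a fm"

primrec neg :: "'a fm \<Rightarrow> 'a fm" where
  "neg (Atom p) = NAtom p"
| "neg (NAtom p) = Atom p"
| "neg (Or A B) = And (neg A) (neg B)"
| "neg (And A B) = Or (neg A) (neg B)"
| "neg (Dia A) = Box (neg A)"
| "neg (Box A) = Dia (neg A)"

datatype 'a item = Fm "'a fm" | Br "'a item multiset"

type_synonym 'a nseq = "'a item multiset"

section \<open>Contexts\<close>

text \<open>\<open>Hole \<Delta>\<close> is the context \<open>\<Delta>, { }\<close>, and \<open>Under \<Delta> C\<close> is \<open>\<Delta>, [C{ }]\<close>.\<close>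

datatype 'a ctx = Hole "'a nseq" | Under "'a nseq" "'a ctx"

primrec fill :: "'a ctx \<Rightarrow> 'a nseq \<Rightarrow> 'a nseq" where
  "fill (Hole \<Delta>) \<Sigma> = \<Delta> + \<Sigma>"
| "fill (Under \<Delta> C) \<Sigma> = \<Delta> + {#Br (fill C \<Sigma>)#}"

primrec depth :: "'a ctx \<Rightarrow> nat" where
  "depth (Hole \<Delta>) = 0"
| "depth (Under \<Delta> C) = Suc (depth C)"

primrec add_ctx :: "'a nseq \<Rightarrow> 'a ctx \<Rightarrow> 'a ctx" where
  "add_ctx \<Theta> (Hole \<Delta>) = Hole (\<Theta> + \<Delta>)"
| "add_ctx \<Theta> (Under \<Delta> C) = Under (\<Theta> + \<Delta>) C"

text \<open>
  A binary context is a chain of boxes shared by both holes (\<open>Under2\<close>), below which the sequent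
  splits as a multiset union \<open>C{ }, D{ }\<close> of a part with the first and a part with the second
  hole (\<open>Split C D\<close>). This covers all relative positions of the two holes, including
  both at the same node and one strictly above the other.
\<close>

datatype 'a ctx2 = Split "'a ctx" "'a ctx" | Under2 "'a nseq" "'a ctx2"

text \<open>\<open>fill_snd C \<Sigma>\<close> is the unary context obtained by filling the second hole only.\<close>

primrec fill_snd :: "'a ctx2 \<Rightarrow> 'a nseq \<Rightarrow> 'a ctx" where
  "fill_snd (Split C D) \<Sigma> = add_ctx (fill D \<Sigma>) C"
| "fill_snd (Under2 \<Delta> C) \<Sigma> = Under \<Delta> (fill_snd C \<Sigma>)"

definition fill2 :: "'a ctx2 \<Rightarrow> 'a nseq \<Rightarrow> 'a nseq \<Rightarrow> 'a nseq" where
  "fill2 C \<Sigma> \<Theta> = fill (fill_snd C \<Theta>) \<Sigma>"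

lemma fill_add_ctx: "fill (add_ctx \<Theta> C) \<Sigma> = \<Theta> + fill C \<Sigma>"
  by (cases C) (auto simp: ac_simps)

lemma fill2_simps:
  "fill2 (Split C D) \<Sigma> \<Theta> = fill C \<Sigma> + fill D \<Theta>"
  "fill2 (Under2 \<Delta> E) \<Sigma> \<Theta> = \<Delta> + {#Br (fill2 E \<Sigma> \<Theta>)#}"
  by (auto simp: fill2_def fill_add_ctx ac_simps)

section \<open>Rules and provability\<close>

text \<open>A rule is the set of its instances, each a list of premises with a conclusion.\<close>

type_synonym 'a rule = "('a nseq list \<times> 'a nseq) set"

definition ax_rule :: "'a rule" where
  "ax_rule = {([], fill C {#Fm (Atom p), Fm (NAtom p)#}) | C p. True}"

definition and_rule :: "'a rule" where
  "and_rule = {([fill C {#Fm A#}, fill C {#Fm B#}], fill C {#Fm (And A B)#}) | C A B. True}"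

definition or_rule :: "'a rule" where
  "or_rule = {([fill C {#Fm A, Fm B#}], fill C {#Fm (Or A B)#}) | C A B. True}"

definition box_rule :: "'a rule" where
  "box_rule = {([fill C {#Br {#Fm A#}#}], fill C {#Fm (Box A)#}) | C A. True}"

definition dia_k_rule :: "'a rule" where
  "dia_k_rule =
    {([fill C {#Fm (Dia A), Br (\<Delta> + {#Fm A#})#}], fill C {#Fm (Dia A), Br \<Delta>#}) | C A \<Delta>. True}"

definition cut_rule :: "'a rule" where
  "cut_rule = {([fill C {#Fm A#}, fill C {#Fm (neg A)#}], fill C {#}) | C A. True}"

datatype modal_axiom = AxD | AxT | AxB | Ax4 | Ax5

primrec dia_rule :: "modal_axiom \<Rightarrow> 'a rule" where
  "dia_rule AxD =
    {([fill C {#Fm (Dia A), Br {#Fm A#}#}], fill C {#Fm (Dia A)#}) | C A. True}"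
| "dia_rule AxT =
    {([fill C {#Fm (Dia A), Fm A#}], fill C {#Fm (Dia A)#}) | C A. True}"
| "dia_rule AxB =
    {([fill C {#Br (\<Delta> + {#Fm (Dia A)#}), Fm A#}], fill C {#Br (\<Delta> + {#Fm (Dia A)#})#})
      | C A \<Delta>. True}"
| "dia_rule Ax4 =
    {([fill C {#Fm (Dia A), Br (\<Delta> + {#Fm (Dia A)#})#}], fill C {#Fm (Dia A), Br \<Delta>#})
      | C A \<Delta>. True}"
| "dia_rule Ax5 =
    {([fill2 C {#Fm (Dia A)#} {#Fm (Dia A)#}], fill2 C {#Fm (Dia A)#} {#})
      | C A. depth (fill_snd C {#}) > 0}"

definition sys_K :: "'a rule" where
  "sys_K = ax_rule \<union> and_rule \<union> or_rule \<union> box_rule \<union> dia_k_rule"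

definition dia_rules :: "modal_axiom set \<Rightarrow> 'a rule" where
  "dia_rules X = (\<Union>\<rho>\<in>X. dia_rule \<rho>)"

inductive provable :: "'a rule \<Rightarrow> 'a nseq \<Rightarrow> bool" for S :: "'a rule" where
  step: "(Ps, \<Gamma>) \<in> S \<Longrightarrow> (\<And>\<Delta>. \<Delta> \<in> set Ps \<Longrightarrow> provable S \<Delta>) \<Longrightarrow> provable S \<Gamma>"

section \<open>Frames and 45-closure\<close>

definition frame :: "'w set \<Rightarrow> ('w \<times> 'w) set \<Rightarrow> bool" where
  "frame W R \<longleftrightarrow> W \<noteq> {} \<and> R \<subseteq> W \<times> W"

primrec frame_cond :: "modal_axiom \<Rightarrow> 'w set \<Rightarrow> ('w \<times> 'w) set \<Rightarrow> bool" where
  "frame_cond AxD W R \<longleftrightarrow> (\<forall>x\<in>W. \<exists>y\<in>W. (x, y) \<in> R)"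
| "frame_cond AxT W R \<longleftrightarrow> (\<forall>x\<in>W. (x, x) \<in> R)"
| "frame_cond AxB W R \<longleftrightarrow> (\<forall>x\<in>W. \<forall>y\<in>W. (x, y) \<in> R \<longrightarrow> (y, x) \<in> R)"
| "frame_cond Ax4 W R \<longleftrightarrow>
    (\<forall>x\<in>W. \<forall>y\<in>W. \<forall>z\<in>W. (x, y) \<in> R \<longrightarrow> (y, z) \<in> R \<longrightarrow> (x, z) \<in> R)"
| "frame_cond Ax5 W R \<longleftrightarrow>
    (\<forall>x\<in>W. \<forall>y\<in>W. \<forall>z\<in>W. (x, y) \<in> R \<longrightarrow> (x, z) \<in> R \<longrightarrow> (y, z) \<in> R)"

text \<open>
  A definition cannot quantify over the type of worlds, so the worlds are natural numbers here;
  \<open>frame_entails_any_type\<close> shows that this amounts to quantifying over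
  the frames of every type.
\<close>

definition frame_entails :: "modal_axiom set \<Rightarrow> modal_axiom \<Rightarrow> bool" where
  "frame_entails X \<rho> \<longleftrightarrow>
    (\<forall>(W :: nat set) R. frame W R \<and> (\<forall>\<sigma>\<in>X. frame_cond \<sigma> W R) \<longrightarrow> frame_cond \<rho> W R)"

definition closed45 :: "modal_axiom set \<Rightarrow> bool" where
  "closed45 X \<longleftrightarrow> (\<forall>\<rho>\<in>{Ax4, Ax5}. frame_entails X \<rho> \<longrightarrow> \<rho> \<in> X)"

lemma frame_cond_image:
  assumes "inj_on g S" "R \<subseteq> S \<times> S"
  shows "frame_cond \<rho> (g ` S) (map_prod g g ` R) \<longleftrightarrow> frame_cond \<rho> S R"
proof -
  have "(g x, g y) \<in> map_prod g g ` R \<longleftrightarrow> (x, y) \<in> R" if "x \<in> S" "y \<in> S" for x y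
  proof
    assume "(g x, g y) \<in> map_prod g g ` R"
    then obtain a b where ab: "(a, b) \<in> R" "g x = g a" "g y = g b" by auto
    then have "a \<in> S" "b \<in> S" using assms(2) by auto
    then show "(x, y) \<in> R" using ab that inj_onD[OF assms(1)] by metis
  qed (force)
  then show ?thesis by (cases \<rho>) simp_all
qed

lemma frame_entails_any_type:
  fixes W :: "'w set"
  assumes ent: "frame_entails X \<rho>" and fr: "frame W R" and X: "\<forall>\<sigma>\<in>X. frame_cond \<sigma> W R"
  shows "frame_cond \<rho> W R"
proof -
  define f where "f x = (if \<exists>y. (x, y) \<in> R then SOME y. (x, y) \<in> R else x)" for x
  have fR: "(x, f x) \<in> R" if "(x, y) \<in> R" for x y
    using someI[of "\<lambda>y. (x, y) \<in> R", OF that] that by (auto simp only: f_def if_True split: if_split)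
  have fW: "f x \<in> W" if "x \<in> W" for x
  proof (cases "\<exists>y. (x, y) \<in> R")
    case True
    then show ?thesis using fR fr unfolding frame_def by blast
  next
    case False
    then show ?thesis using that by (simp add: f_def)
  qed
  have sub: "\<exists>S. A \<subseteq> S \<and> S \<subseteq> W \<and> frame_cond \<rho> S (R \<inter> S \<times> S)"
    if A: "finite A" "A \<noteq> {}" "A \<subseteq> W" for A
  proof -
    define S where "S = (\<Union>n. (f ^^ n) ` A)"
    have S: "countable S" "A \<subseteq> S"
    proof -
      show "countable S" using A by (auto simp: S_def countable_finite)
      show "A \<subseteq> S" unfolding S_def by (rule subsetI, rule UN_I[of 0]) auto
    qed
    have "(f ^^ n) x \<in> W" if "x \<in> W" for n x using that fW by (induction n) auto
    then have SW: "S \<subseteq> W" using A by (auto simp: S_def)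
    have fS: "f x \<in> S" if "x \<in> S" for x
    proof -
      obtain n a where "a \<in> A" "x = (f ^^ n) a" using \<open>x \<in> S\<close> by (auto simp: S_def)
      then have "a \<in> A" "f x = (f ^^ Suc n) a" by auto
      then show ?thesis unfolding S_def by blast
    qed
    define g where "g = to_nat_on S"
    have g: "inj_on g S" using S unfolding g_def by (intro inj_on_to_nat_on)
    let ?R = "R \<inter> S \<times> S"
    have condS: "frame_cond \<sigma> S ?R" if "frame_cond \<sigma> W R" for \<sigma>
    proof (cases \<sigma>)
      case AxD
      have "\<exists>y\<in>S. (x, y) \<in> ?R" if "x \<in> S" for x
      proof -
        obtain y where "(x, y) \<in> R" using \<open>frame_cond \<sigma> W R\<close> AxD SW \<open>x \<in> S\<close> by auto
        then show ?thesis using fR fS \<open>x \<in> S\<close> by blast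
      qed
      then show ?thesis using AxD by simp
    next
      case AxT
      then show ?thesis using that SW unfolding AxT frame_cond.simps by blast
    next
      case AxB
      then show ?thesis using that SW unfolding AxB frame_cond.simps by blast
    next
      case Ax4
      then show ?thesis using that SW unfolding Ax4 frame_cond.simps by blast
    next
      case Ax5
      then show ?thesis using that SW unfolding Ax5 frame_cond.simps by blast
    qed
    have "frame (g ` S) (map_prod g g ` ?R)" using S A by (auto simp: frame_def)
    moreover have "\<forall>\<sigma>\<in>X. frame_cond \<sigma> (g ` S) (map_prod g g ` ?R)"
      using X condS by (simp add: frame_cond_image[OF g])
    ultimately have "frame_cond \<rho> (g ` S) (map_prod g g ` ?R)"
      using ent by (auto simp: frame_entails_def)
    then have "frame_cond \<rho> S ?R" by (simp add: frame_cond_image[OF g])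
    then show ?thesis using S SW by blast
  qed
  have sub3: thesis
    if "x \<in> W" "y \<in> W" "z \<in> W"
      and "\<And>S. x \<in> S \<Longrightarrow> y \<in> S \<Longrightarrow> z \<in> S \<Longrightarrow> S \<subseteq> W
        \<Longrightarrow> frame_cond \<rho> S (R \<inter> S \<times> S) \<Longrightarrow> thesis"
    for x y z thesis
  proof -
    have "finite {x, y, z}" "{x, y, z} \<noteq> {}" "{x, y, z} \<subseteq> W" using that(1-3) by simp_all
    from sub[OF this] obtain S
      where "{x, y, z} \<subseteq> S" "S \<subseteq> W" "frame_cond \<rho> S (R \<inter> S \<times> S)" by iprover
    then show thesis by (intro that(4)[of S]) simp_all
  qed
  show ?thesis
  proof (cases \<rho>)
    case AxD
    have "\<exists>y\<in>W. (x, y) \<in> R" if A: "x \<in> W" for x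
    proof -
      obtain S where S: "x \<in> S" "x \<in> S" "x \<in> S" "S \<subseteq> W" and c: "frame_cond \<rho> S (R \<inter> S \<times> S)"
        by (rule sub3[OF A A A])
      from c[unfolded AxD frame_cond.simps] show ?thesis using S A by blast
    qed
    then show ?thesis unfolding AxD frame_cond.simps by blast
  next
    case AxT
    have "(x, x) \<in> R" if A: "x \<in> W" for x
    proof -
      obtain S where S: "x \<in> S" "x \<in> S" "x \<in> S" "S \<subseteq> W" and c: "frame_cond \<rho> S (R \<inter> S \<times> S)"
        by (rule sub3[OF A A A])
      from c[unfolded AxT frame_cond.simps] show ?thesis using S A by blast
    qed
    then show ?thesis unfolding AxT frame_cond.simps by blast
  next
    case AxB
    have "(y, x) \<in> R" if A: "x \<in> W" "y \<in> W" "(x, y) \<in> R" for x y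
    proof -
      obtain S where S: "x \<in> S" "y \<in> S" "x \<in> S" "S \<subseteq> W" and c: "frame_cond \<rho> S (R \<inter> S \<times> S)"
        by (rule sub3[OF A(1) A(2) A(1)])
      from c[unfolded AxB frame_cond.simps] show ?thesis using S A by blast
    qed
    then show ?thesis unfolding AxB frame_cond.simps by blast
  next
    case Ax4
    have "(x, z) \<in> R" if A: "x \<in> W" "y \<in> W" "z \<in> W" "(x, y) \<in> R" "(y, z) \<in> R" for x y z
    proof -
      obtain S where S: "x \<in> S" "y \<in> S" "z \<in> S" "S \<subseteq> W" and c: "frame_cond \<rho> S (R \<inter> S \<times> S)"
        by (rule sub3[OF A(1) A(2) A(3)])
      from c[unfolded Ax4 frame_cond.simps] show ?thesis using S A by blast
    qed
    then show ?thesis unfolding Ax4 frame_cond.simps by blast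
  next
    case Ax5
    have "(y, z) \<in> R" if A: "x \<in> W" "y \<in> W" "z \<in> W" "(x, y) \<in> R" "(x, z) \<in> R" for x y z
    proof -
      obtain S where S: "x \<in> S" "y \<in> S" "z \<in> S" "S \<subseteq> W" and c: "frame_cond \<rho> S (R \<inter> S \<times> S)"
        by (rule sub3[OF A(1) A(2) A(3)])
      from c[unfolded Ax5 frame_cond.simps] show ?thesis using S A by blast
    qed
    then show ?thesis unfolding Ax5 frame_cond.simps by blast
  qed
qed

end

theory Submission
  imports Defs
begin

text \<open>
  The proof is semantic: a sequent provable with cut is valid in all frames of \<open>X\<close>, and a sequent
  unprovable without cut has a countermodel on such a frame. Read upwards, a diamond rule only adds
  a formula or a box at some node, so starting from an unprovable sequent one can fairly apply all
  rules while staying unprovable. To avoid contraction, compound formulas are first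
  decomposed into literals and diamonds, and each stage is tracked by a set-based labelled tree that
  maps homomorphically to the current sequent. The union of the stages is a possibly
  infinite tree; when \<open>X\<close> is 45-closed, the local rules suffice for diamonds to be refuted along
  an extension of its child relation that satisfies the conditions of \<open>X\<close>.
\<close>

section \<open>Semantics and soundness\<close>

text \<open>Two features of the calculus shape the construction. The rules for \<open>And\<close>,
  \<open>Or\<close> and \<open>Box\<close> consume their principal formula, so of the formulas in a
  sequent only literals and diamonds persist from stage to stage; compounds are remembered through
  \<open>refines\<close>, which carries refutation back to them in every model over the label type.
  Moreover, occurrences in a multiset have no identity: two equal boxes cannot be told apart. The
  labels supply that identity, and the embedding of the tree may be rechosen at each stage. Closure
  bridges a gap between rules and frame conditions. With \<open>AxT\<close> and \<open>Ax5\<close>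
  but not \<open>Ax4\<close>, no rule copies a diamond away from the root, because rule 5 demands
  positive depth; yet reflexive euclidean frames are transitive. With only \<open>AxB\<close> and
  \<open>Ax4\<close>, diamonds are copied downwards only, although symmetric transitive frames are
  euclidean.\<close>

primrec holds :: "('w \<times> 'w) set \<Rightarrow> ('w \<Rightarrow> 'a \<Rightarrow> bool) \<Rightarrow> 'w \<Rightarrow> 'a fm \<Rightarrow> bool" where
  "holds R V w (Atom p) \<longleftrightarrow> V w p"
| "holds R V w (NAtom p) \<longleftrightarrow> \<not> V w p"
| "holds R V w (Or A B) \<longleftrightarrow> holds R V w A \<or> holds R V w B"
| "holds R V w (And A B) \<longleftrightarrow> holds R V w A \<and> holds R V w B"
| "holds R V w (Dia A) \<longleftrightarrow> (\<exists>v. (w, v) \<in> R \<and> holds R V v A)"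
| "holds R V w (Box A) \<longleftrightarrow> (\<forall>v. (w, v) \<in> R \<longrightarrow> holds R V v A)"

lemma holds_neg: "holds R V w (neg A) \<longleftrightarrow> \<not> holds R V w A"
  by (induction A arbitrary: w) auto

text \<open>A sequent stands for the disjunction of its items and a box for \<open>Box\<close>, so
  refuting a sequent means refuting all items at one world. The world is the last argument because
  recursion through the multiset maps the partial application over the items while the world
  changes.\<close>

primrec refutes_item ::
    "('w \<times> 'w) set \<Rightarrow> ('w \<Rightarrow> 'a \<Rightarrow> bool) \<Rightarrow> 'a item \<Rightarrow> 'w \<Rightarrow> bool" where
  "refutes_item R V (Fm A) = (\<lambda>w. \<not> holds R V w A)"
| "refutes_item R V (Br \<Delta>) =
    (\<lambda>w. \<exists>v. (w, v) \<in> R \<and> (\<forall>f\<in>#image_mset (refutes_item R V) \<Delta>. f v))"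

definition refutes ::
    "('w \<times> 'w) set \<Rightarrow> ('w \<Rightarrow> 'a \<Rightarrow> bool) \<Rightarrow> 'w \<Rightarrow> 'a nseq \<Rightarrow> bool" where
  "refutes R V w \<Gamma> \<longleftrightarrow> (\<forall>i\<in>#\<Gamma>. refutes_item R V i w)"

lemma refutes_simps [simp]:
  "refutes R V w {#}"
  "refutes R V w (add_mset (Fm A) \<Gamma>) \<longleftrightarrow> \<not> holds R V w A \<and> refutes R V w \<Gamma>"
  "refutes R V w (add_mset (Br \<Delta>) \<Gamma>) \<longleftrightarrow>
    (\<exists>v. (w, v) \<in> R \<and> refutes R V v \<Delta>) \<and> refutes R V w \<Gamma>"
  "refutes R V w (\<Gamma> + \<Delta>) \<longleftrightarrow> refutes R V w \<Gamma> \<and> refutes R V w \<Delta>"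
  by (auto simp: refutes_def)

lemma refutes_fill_mono:
  assumes "\<And>v. refutes R V v \<Sigma> \<Longrightarrow> refutes R V v \<Theta>"
  shows "refutes R V w (fill C \<Sigma>) \<Longrightarrow> refutes R V w (fill C \<Theta>)"
  using assms by (induction C arbitrary: w) auto

text \<open>Descending along \<open>C\<close> fixes one witness per box; these witnesses serve any
  other filling of the hole, which gives the last clause. The strict reachability at positive depth
  prepares for the side condition of rule 5.\<close>

lemma refutes_fillE:
  assumes "refutes R V w (fill C \<Sigma>)"
  obtains v where "(w, v) \<in> R\<^sup>*" "0 < depth C \<Longrightarrow> (w, v) \<in> R\<^sup>+" "refutes R V v \<Sigma>"
    "\<And>\<Theta>. refutes R V v \<Theta> \<Longrightarrow> refutes R V w (fill C \<Theta>)"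
  using assms
proof (induction C arbitrary: w thesis)
  case (Hole \<Delta>)
  then show ?case by auto
next
  case (Under \<Delta> C)
  then obtain u where u: "(w, u) \<in> R" "refutes R V u (fill C \<Sigma>)" by auto
  from Under.IH[OF _ u(2)] obtain v where v: "(u, v) \<in> R\<^sup>*" "refutes R V v \<Sigma>"
    "\<And>\<Theta>. refutes R V v \<Theta> \<Longrightarrow> refutes R V u (fill C \<Theta>)" by blast
  show ?case
  proof (rule Under.prems(1)[of v])
    show "(w, v) \<in> R\<^sup>*" "(w, v) \<in> R\<^sup>+"
      using u(1) v(1) by (auto intro: rtrancl_into_trancl2 converse_rtrancl_into_rtrancl)
    show "refutes R V v \<Sigma>" by fact
    show "refutes R V w (fill (Under \<Delta> C) \<Theta>)" if "refutes R V v \<Theta>" for \<Theta>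
      using Under.prems(2) u(1) v(3)[OF that] by auto
  qed
qed

lemma depth_add_ctx [simp]: "depth (add_ctx \<Theta> C) = depth C"
  by (cases C) auto

lemma refutes_fill2E:
  assumes "refutes R V w (fill2 C \<Sigma> \<Theta>)"
  obtains u v where "0 < depth (fill_snd C {#}) \<Longrightarrow> (w, u) \<in> R\<^sup>+" "(w, v) \<in> R\<^sup>*"
    "refutes R V u \<Sigma>" "\<And>\<Omega>. refutes R V v \<Omega> \<Longrightarrow> refutes R V w (fill2 C \<Sigma> \<Omega>)"
proof -
  have "\<exists>u v. (w, u) \<in> R\<^sup>* \<and> (0 < depth (fill_snd C {#}) \<longrightarrow> (w, u) \<in> R\<^sup>+) \<and> (w, v) \<in> R\<^sup>* \<and>
    refutes R V u \<Sigma> \<and> (\<forall>\<Omega>. refutes R V v \<Omega> \<longrightarrow> refutes R V w (fill2 C \<Sigma> \<Omega>))"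
    using assms
  proof (induction C arbitrary: w)
    case (Split C D)
    then have C: "refutes R V w (fill C \<Sigma>)" and D: "refutes R V w (fill D \<Theta>)"
      by (auto simp: fill2_simps)
    obtain u where u: "(w, u) \<in> R\<^sup>*" "0 < depth C \<Longrightarrow> (w, u) \<in> R\<^sup>+" "refutes R V u \<Sigma>"
      by (rule refutes_fillE[OF C], rule that) simp_all
    obtain v where v: "(w, v) \<in> R\<^sup>*" "\<And>\<Omega>. refutes R V v \<Omega> \<Longrightarrow> refutes R V w (fill D \<Omega>)"
      by (rule refutes_fillE[OF D], rule that) simp_all
    show ?case using u v C by (intro exI[of _ u] exI[of _ v]) (auto simp: fill2_simps)
  next
    case (Under2 \<Delta> C)
    then obtain x where x: "(w, x) \<in> R" "refutes R V x (fill2 C \<Sigma> \<Theta>)"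
      by (auto simp: fill2_simps)
    from Under2.IH[OF x(2)] obtain u v where uv: "(x, u) \<in> R\<^sup>*" "(x, v) \<in> R\<^sup>*"
      "refutes R V u \<Sigma>" "\<And>\<Omega>. refutes R V v \<Omega> \<Longrightarrow> refutes R V x (fill2 C \<Sigma> \<Omega>)" by blast
    have "(w, u) \<in> R\<^sup>+" "(w, v) \<in> R\<^sup>+" using x(1) uv by (auto intro: rtrancl_into_trancl2)
    moreover have "refutes R V w (fill2 (Under2 \<Delta> C) \<Sigma> \<Omega>)" if "refutes R V v \<Omega>" for \<Omega>
      using Under2.prems x(1) uv(4)[OF that] by (auto simp: fill2_simps)
    ultimately show ?case using uv(3) by (auto intro: trancl_into_rtrancl)
  qed
  then show ?thesis using that by metis
qed

text \<open>A world with a predecessor sees itself, and then everything it sees sees it back, so the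
  worlds strictly after \<open>w\<close> form a cluster. Hence a diamond refuted strictly after
  \<open>w\<close> has its body refuted at all worlds strictly after \<open>w\<close>: the reason
  for the depth condition of rule 5.\<close>

lemma euclidean_trancl:
  assumes euc: "\<And>x y z. (x, y) \<in> R \<Longrightarrow> (x, z) \<in> R \<Longrightarrow> (y, z) \<in> R"
    and "(w, u) \<in> R\<^sup>+" "(w, v) \<in> R\<^sup>+"
  shows "(u, v) \<in> R"
proof -
  have succ: "(u, y) \<in> R" if "(w, u) \<in> R\<^sup>+" "(w, y) \<in> R" for u y
    using that by (induction rule: trancl_induct) (blast intro: euc)+
  from assms(3) show ?thesis
  proof (induction rule: trancl_induct)
    case (base y)
    then show ?case using succ assms(2) by blast
  next
    case (step y z)
    obtain p where "(p, u) \<in> R" using assms(2) by (auto elim: trancl.cases)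
    then have "(u, u) \<in> R" using euc by blast
    then have "(y, u) \<in> R" using euc step.IH by blast
    then show ?case using euc step.hyps(2) by blast
  qed
qed

lemma sys_sound:
  assumes fr: "frame W R" and X: "\<forall>\<sigma>\<in>X. frame_cond \<sigma> W R" and w: "w \<in> W"
    and inst: "(Ps, \<Gamma>) \<in> sys_K \<union> dia_rules X \<union> cut_rule" and ref: "refutes R V w \<Gamma>"
  shows "\<exists>\<Delta>\<in>set Ps. refutes R V w \<Delta>"
proof -
  have RW: "R \<subseteq> W \<times> W" using fr by (simp add: frame_def)
  have inW: "v \<in> W" if "(w, v) \<in> R\<^sup>*" for v
    using that w RW by (induction rule: rtrancl_induct) auto
  \<comment> \<open>For \<open>and_rule\<close> and cut the choice of the premise depends on the
    world of the hole, so the hole is located first. Membership in \<open>W\<close> is carried along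
    because frame conditions speak only of worlds in \<open>W\<close>.\<close>
  have fillI: "\<exists>\<Delta>\<in>set Ps. refutes R V w \<Delta>"
    if "\<Gamma> = fill C \<Sigma>"
      "\<And>v. v \<in> W \<Longrightarrow> refutes R V v \<Sigma> \<Longrightarrow> \<exists>\<Theta>. fill C \<Theta> \<in> set Ps \<and> refutes R V v \<Theta>"
    for C \<Sigma>
    using that ref refutes_fillE inW by metis
  have fillD: "refutes R V w (fill C \<Theta>)"
    if "refutes R V w (fill C \<Sigma>)" "\<And>v. v \<in> W \<Longrightarrow> refutes R V v \<Sigma> \<Longrightarrow> refutes R V v \<Theta>"
    for C \<Sigma> \<Theta>
    using that refutes_fillE inW by metis
  from inst consider "(Ps, \<Gamma>) \<in> ax_rule" | "(Ps, \<Gamma>) \<in> and_rule" | "(Ps, \<Gamma>) \<in> or_rule"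
    | "(Ps, \<Gamma>) \<in> box_rule" | "(Ps, \<Gamma>) \<in> dia_k_rule" | "(Ps, \<Gamma>) \<in> cut_rule"
    | \<rho> where "\<rho> \<in> X" "(Ps, \<Gamma>) \<in> dia_rule \<rho>"
    by (auto simp: sys_K_def dia_rules_def)
  then show ?thesis
  proof cases
    case 1
    then obtain C p where "\<Gamma> = fill C {#Fm (Atom p), Fm (NAtom p)#}" by (auto simp: ax_rule_def)
    then show ?thesis by (rule fillI) auto
  next
    case 2
    then obtain C A B where CAB: "Ps = [fill C {#Fm A#}, fill C {#Fm B#}]"
      "\<Gamma> = fill C {#Fm (And A B)#}" by (auto simp: and_rule_def)
    show ?thesis
    proof (rule fillI[OF CAB(2)])
      fix v
      assume "refutes R V v {#Fm (And A B)#}"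
      then have "refutes R V v {#Fm A#} \<or> refutes R V v {#Fm B#}" by auto
      then show "\<exists>\<Theta>. fill C \<Theta> \<in> set Ps \<and> refutes R V v \<Theta>" unfolding CAB by auto
    qed
  next
    case 3
    then show ?thesis using ref by (auto simp: or_rule_def elim!: fillD)
  next
    case 4
    then show ?thesis using ref by (auto simp: box_rule_def elim!: fillD)
  next
    case 5
    then show ?thesis using ref by (auto simp: dia_k_rule_def elim!: fillD) blast
  next
    case 6
    then obtain C A where CA: "Ps = [fill C {#Fm A#}, fill C {#Fm (neg A)#}]" "\<Gamma> = fill C {#}"
      by (auto simp: cut_rule_def)
    show ?thesis
    proof (rule fillI[OF CA(2)])
      fix v
      have "refutes R V v {#Fm A#} \<or> refutes R V v {#Fm (neg A)#}" by (simp add: holds_neg)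
      then show "\<exists>\<Theta>. fill C \<Theta> \<in> set Ps \<and> refutes R V v \<Theta>" unfolding CA by auto
    qed
  next
    case (7 \<rho>)
    then have c: "frame_cond \<rho> W R" using X by blast
    show ?thesis
    proof (cases \<rho>)
      case AxD
      then show ?thesis using 7 c ref by (auto elim!: fillD) blast
    next
      case AxT
      then show ?thesis using 7 c ref by (auto elim!: fillD)
    next
      case AxB
      then show ?thesis using 7 c RW ref by (auto elim!: fillD) blast
    next
      case Ax4
      then show ?thesis using 7 c RW ref by (auto elim!: fillD) blast
    next
      case Ax5
      with 7 obtain C A where CA: "Ps = [fill2 C {#Fm (Dia A)#} {#Fm (Dia A)#}]"
        "\<Gamma> = fill2 C {#Fm (Dia A)#} {#}" "depth (fill_snd C {#}) > 0" by auto
      from ref CA refutes_fill2E obtain u v where uv: "(w, u) \<in> R\<^sup>+" "(w, v) \<in> R\<^sup>*"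
        "refutes R V u {#Fm (Dia A)#}"
        "\<And>\<Omega>. refutes R V v \<Omega> \<Longrightarrow> refutes R V w (fill2 C {#Fm (Dia A)#} \<Omega>)"
        by metis
      have euc: "(y, z) \<in> R" if "(x, y) \<in> R" "(x, z) \<in> R" for x y z
        using c Ax5 RW that by auto
      have "\<not> holds R V y A" if "(v, y) \<in> R" for y
        using euclidean_trancl[OF euc uv(1) rtrancl_into_trancl1[OF uv(2) that]] uv(3) by auto
      then show ?thesis using uv(4) CA by auto
    qed
  qed
qed

theorem soundness:
  assumes "provable (sys_K \<union> dia_rules X \<union> cut_rule) \<Gamma>"
    and "frame W R" "\<forall>\<sigma>\<in>X. frame_cond \<sigma> W R" "w \<in> W"
  shows "\<not> refutes R V w \<Gamma>"
  using assms(1)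
proof (induction)
  case (step Ps \<Gamma>)
  then show ?case using sys_sound[OF assms(2-4)] by metis
qed

section \<open>Decomposition into literals and diamonds\<close>

primrec ctx_comp :: "'a ctx \<Rightarrow> 'a ctx \<Rightarrow> 'a ctx" where
  "ctx_comp (Hole \<Delta>) D = add_ctx \<Delta> D"
| "ctx_comp (Under \<Delta> C) D = Under \<Delta> (ctx_comp C D)"

lemma fill_comp [simp]: "fill (ctx_comp C D) \<Sigma> = fill C (fill D \<Sigma>)"
  by (induction C) (auto simp: fill_add_ctx)

lemma depth_comp [simp]: "depth (ctx_comp C D) = depth C + depth D"
  by (induction C) auto

lemma fill_union: "fill C (\<Pi> + \<Sigma>) = fill (ctx_comp C (Hole \<Pi>)) \<Sigma>"
  by simp

primrec all_fm_item :: "('a fm \<Rightarrow> bool) \<Rightarrow> 'a item \<Rightarrow> bool" where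
  "all_fm_item P (Fm A) \<longleftrightarrow> P A"
| "all_fm_item P (Br \<Delta>) \<longleftrightarrow> (\<forall>b\<in>#image_mset (all_fm_item P) \<Delta>. b)"

definition all_fm :: "('a fm \<Rightarrow> bool) \<Rightarrow> 'a nseq \<Rightarrow> bool" where
  "all_fm P \<Gamma> \<longleftrightarrow> (\<forall>i\<in>#\<Gamma>. all_fm_item P i)"

lemma all_fm_simps [simp]:
  "all_fm P {#}"
  "all_fm P (add_mset (Fm A) \<Gamma>) \<longleftrightarrow> P A \<and> all_fm P \<Gamma>"
  "all_fm P (add_mset (Br \<Delta>) \<Gamma>) \<longleftrightarrow> all_fm P \<Delta> \<and> all_fm P \<Gamma>"
  "all_fm P (\<Gamma> + \<Delta>) \<longleftrightarrow> all_fm P \<Gamma> \<and> all_fm P \<Delta>"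
  by (auto simp: all_fm_def)

lemma all_fm_fill_mono: "(all_fm P \<Sigma> \<Longrightarrow> all_fm P \<Theta>) \<Longrightarrow> all_fm P (fill C \<Sigma>) \<Longrightarrow> all_fm P (fill C \<Theta>)"
  by (induction C) auto

lemma all_fm_item_mono: "all_fm_item P i \<Longrightarrow> (\<And>A. P A \<Longrightarrow> Q A) \<Longrightarrow> all_fm_item Q i"
  by (induction i) auto

lemma all_fm_item_conj:
  "all_fm_item P i \<Longrightarrow> all_fm_item Q i \<Longrightarrow> all_fm_item (\<lambda>A. P A \<and> Q A) i"
  by (induction i) auto

lemma all_fm_mono: "all_fm P \<Gamma> \<Longrightarrow> (\<And>A. P A \<Longrightarrow> Q A) \<Longrightarrow> all_fm Q \<Gamma>"
  unfolding all_fm_def using all_fm_item_mono by blast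

lemma all_fm_conj: "all_fm P \<Gamma> \<Longrightarrow> all_fm Q \<Gamma> \<Longrightarrow> all_fm (\<lambda>A. P A \<and> Q A) \<Gamma>"
  unfolding all_fm_def using all_fm_item_conj by blast

text \<open>Boxes weigh nothing, so replacing \<open>Box A\<close> by a boxed \<open>A\<close>
  lowers the weight just as splitting a connective does.\<close>

primrec weight_item :: "'a item \<Rightarrow> nat" where
  "weight_item (Fm A) = size A"
| "weight_item (Br \<Delta>) = sum_mset (image_mset weight_item \<Delta>)"

definition weight :: "'a nseq \<Rightarrow> nat" where
  "weight \<Gamma> = sum_mset (image_mset weight_item \<Gamma>)"

lemma weight_simps [simp]:
  "weight {#} = 0"
  "weight (add_mset (Fm A) \<Gamma>) = size A + weight \<Gamma>"
  "weight (add_mset (Br \<Delta>) \<Gamma>) = weight \<Delta> + weight \<Gamma>"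
  "weight (\<Gamma> + \<Delta>) = weight \<Gamma> + weight \<Delta>"
  by (auto simp: weight_def)

lemma weight_fill_less: "weight \<Sigma> < weight \<Theta> \<Longrightarrow> weight (fill C \<Sigma>) < weight (fill C \<Theta>)"
  by (induction C) auto

definition simple :: "'a fm \<Rightarrow> bool" where
  "simple A \<longleftrightarrow> (\<exists>p. A = Atom p) \<or> (\<exists>p. A = NAtom p) \<or> (\<exists>B. A = Dia B)"

lemma simple_simps [simp]:
  "simple (Atom p)" "simple (NAtom p)" "simple (Dia A)"
  "\<not> simple (Or A B)" "\<not> simple (And A B)" "\<not> simple (Box A)"
  by (auto simp: simple_def)

lemma compound_occurs:
  assumes "\<not> all_fm simple \<Gamma>"
  obtains C A where "\<Gamma> = fill C {#Fm A#}" "\<not> simple A"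
proof -
  have "\<exists>C A. add_mset i \<Gamma> = fill C {#Fm A#} \<and> \<not> simple A" if "\<not> all_fm_item simple i" for i \<Gamma>
    using that
  proof (induction i arbitrary: \<Gamma>)
    case (Fm A)
    then show ?case by (intro exI[of _ "Hole \<Gamma>"] exI[of _ A]) auto
  next
    case (Br \<Delta>)
    then obtain j \<Delta>' where "\<Delta> = add_mset j \<Delta>'" "\<not> all_fm_item simple j"
      by (auto dest: multi_member_split)
    with Br.IH obtain C A where "\<Delta> = fill C {#Fm A#}" "\<not> simple A" by fastforce
    then show ?case by (intro exI[of _ "Under \<Gamma> C"] exI[of _ A]) auto
  qed
  moreover obtain i \<Gamma>' where "\<Gamma> = add_mset i \<Gamma>'" "\<not> all_fm_item simple i"
    using assms by (auto simp: all_fm_def dest: multi_member_split)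
  ultimately show ?thesis using that by metis
qed

text \<open>
  \<open>refines \<Sigma>' \<Sigma>\<close> collects what the countermodel needs of a decomposition
  \<open>\<Sigma>'\<close> of \<open>\<Sigma>\<close>; its worlds will be the labels of nodes, whence the
  type of worlds.
\<close>

definition refines :: "'a nseq \<Rightarrow> 'a nseq \<Rightarrow> bool" where
  "refines \<Sigma>' \<Sigma> \<longleftrightarrow>
    (\<forall>(R :: (nat list \<times> nat list) set) V w. refutes R V w \<Sigma>' \<longrightarrow> refutes R V w \<Sigma>) \<and>
    (\<forall>n. all_fm (\<lambda>A. size A \<le> n) \<Sigma> \<longrightarrow> all_fm (\<lambda>A. size A \<le> n) \<Sigma>') \<and>
    (\<forall>A. simple A \<longrightarrow> Fm A \<in># \<Sigma> \<longrightarrow> Fm A \<in># \<Sigma>') \<and>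
    ((\<exists>\<Delta>. Br \<Delta> \<in># \<Sigma>) \<longrightarrow> (\<exists>\<Delta>. Br \<Delta> \<in># \<Sigma>'))"

lemma refines_refl: "refines \<Sigma> \<Sigma>"
  by (simp add: refines_def)

lemma refines_trans: "refines \<Sigma>'' \<Sigma>' \<Longrightarrow> refines \<Sigma>' \<Sigma> \<Longrightarrow> refines \<Sigma>'' \<Sigma>"
  unfolding refines_def by meson

lemma refines_fill:
  assumes "\<And>(R :: (nat list \<times> nat list) set) V w. refutes R V w \<Psi> \<Longrightarrow> \<not> holds R V w A"
    and "\<not> simple A" "\<And>n. size A \<le> n \<Longrightarrow> all_fm (\<lambda>A. size A \<le> n) \<Psi>"
  shows "refines (fill C \<Psi>) (fill C {#Fm A#})"
  unfolding refines_def
proof (intro conjI allI impI)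
  show "refutes R V w (fill C {#Fm A#})" if "refutes R V w (fill C \<Psi>)"
    for R V and w :: "nat list"
    using refutes_fill_mono[OF _ that] assms(1) by auto
  show "all_fm (\<lambda>A. size A \<le> n) (fill C \<Psi>)" if "all_fm (\<lambda>A. size A \<le> n) (fill C {#Fm A#})" for n
    using all_fm_fill_mono[OF _ that] assms(3) by auto
  show "Fm B \<in># fill C \<Psi>" if "simple B" "Fm B \<in># fill C {#Fm A#}" for B
    using that assms(2) by (cases C) auto
  show "\<exists>\<Delta>. Br \<Delta> \<in># fill C \<Psi>" if "\<exists>\<Delta>. Br \<Delta> \<in># fill C {#Fm A#}"
    using that by (cases C) auto
qed

lemma provableI:
  "(Ps, \<Gamma>) \<in> S \<Longrightarrow> \<forall>\<Delta>\<in>set Ps. provable S \<Delta> \<Longrightarrow> provable S \<Gamma>"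
  by (rule provable.step) auto

text \<open>An unprovable conclusion has an unprovable premise, so compounds of \<Sigma> are broken
  up in place; for \<open>And\<close>, a conjunct is kept whose premise is unprovable. The context
  \<open>C\<close> stays as it is, so what earlier stages established there remains.\<close>

lemma simple_refinement:
  assumes "sys_K \<subseteq> S" "\<not> provable S (fill C \<Sigma>)"
  obtains \<Sigma>' where "refines \<Sigma>' \<Sigma>" "all_fm simple \<Sigma>'" "\<not> provable S (fill C \<Sigma>')"
  using assms(2)
proof (induction "weight \<Sigma>" arbitrary: \<Sigma> thesis rule: less_induct)
  case less
  show ?case
  proof (cases "all_fm simple \<Sigma>")
    case True
    then show ?thesis using less.prems refines_refl by blast
  next
    case False
    then obtain E A where \<Sigma>: "\<Sigma> = fill E {#Fm A#}" and A: "\<not> simple A"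
      by (rule compound_occurs)
    have red: thesis
      if "refines (fill E \<Psi>) \<Sigma>" "weight \<Psi> < weight {#Fm A#}" "\<not> provable S (fill C (fill E \<Psi>))"
      for \<Psi>
      using less.hyps[of "fill E \<Psi>"] weight_fill_less[OF that(2), of E] that(1,3) less.prems(1)
        refines_trans \<Sigma> by metis
    have nS: "\<not> provable S (fill (ctx_comp C E) {#Fm A#})" using less.prems \<Sigma> by simp
    have K: "(Ps, \<Gamma>) \<in> S" if "(Ps, \<Gamma>) \<in> and_rule \<union> or_rule \<union> box_rule" for Ps \<Gamma>
      using that assms(1) by (auto simp: sys_K_def)
    show ?thesis
    proof (cases A)
      case (Or B D)
      have "([fill (ctx_comp C E) {#Fm B, Fm D#}], fill (ctx_comp C E) {#Fm A#}) \<in> S"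
        unfolding Or by (rule K) (unfold or_rule_def, blast)
      then have "\<not> provable S (fill C (fill E {#Fm B, Fm D#}))"
        using provableI[where S = S] nS by fastforce
      moreover have "refines (fill E {#Fm B, Fm D#}) \<Sigma>"
        unfolding \<Sigma> by (rule refines_fill) (auto simp: Or)
      ultimately show ?thesis using red[of "{#Fm B, Fm D#}"] Or by auto
    next
      case (And B D)
      have "([fill (ctx_comp C E) {#Fm B#}, fill (ctx_comp C E) {#Fm D#}], fill (ctx_comp C E) {#Fm A#}) \<in> S"
        unfolding And by (rule K) (unfold and_rule_def, blast)
      then have "\<not> provable S (fill C (fill E {#Fm B#})) \<or> \<not> provable S (fill C (fill E {#Fm D#}))"
        using provableI[where S = S] nS by fastforce
      moreover have "refines (fill E {#Fm B#}) \<Sigma>" "refines (fill E {#Fm D#}) \<Sigma>"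
        unfolding \<Sigma> by (rule refines_fill; auto simp: And)+
      ultimately show ?thesis using red[of "{#Fm B#}"] red[of "{#Fm D#}"] And by auto
    next
      case (Box B)
      have "([fill (ctx_comp C E) {#Br {#Fm B#}#}], fill (ctx_comp C E) {#Fm A#}) \<in> S"
        unfolding Box by (rule K) (unfold box_rule_def, blast)
      then have "\<not> provable S (fill C (fill E {#Br {#Fm B#}#}))"
        using provableI[where S = S] nS by fastforce
      moreover have "refines (fill E {#Br {#Fm B#}#}) \<Sigma>"
        unfolding \<Sigma> by (rule refines_fill) (auto simp: Box)
      ultimately show ?thesis using red[of "{#Br {#Fm B#}#}"] Box by auto
    qed (use A in auto)
  qed
qed

section \<open>Frames on trees of labels\<close>

text \<open>Closure enters the whole proof only through these three implications, each an elementary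
  fact about relations: symmetry, for instance, turns transitivity and the euclidean law into each
  other.\<close>

lemma closed45D:
  assumes "closed45 X"
  shows "AxB \<in> X \<Longrightarrow> Ax4 \<in> X \<Longrightarrow> Ax5 \<in> X"
    and "AxB \<in> X \<Longrightarrow> Ax5 \<in> X \<Longrightarrow> Ax4 \<in> X"
    and "AxT \<in> X \<Longrightarrow> Ax5 \<in> X \<Longrightarrow> Ax4 \<in> X"
proof -
  have ent: "\<rho> \<in> X" if "\<rho> \<in> {Ax4, Ax5}"
    "\<And>(W :: nat set) R. R \<subseteq> W \<times> W \<Longrightarrow> \<forall>\<sigma>\<in>X. frame_cond \<sigma> W R \<Longrightarrow> frame_cond \<rho> W R" for \<rho>
  proof -
    have "frame_entails X \<rho>" unfolding frame_entails_def frame_def using that(2) by blast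
    then show ?thesis using assms that(1) unfolding closed45_def by blast
  qed
  show "Ax5 \<in> X" if X: "AxB \<in> X" "Ax4 \<in> X"
  proof (rule ent)
    fix W :: "nat set" and R
    assume "\<forall>\<sigma>\<in>X. frame_cond \<sigma> W R"
    then have "frame_cond AxB W R" "frame_cond Ax4 W R" using X by blast+
    then show "frame_cond Ax5 W R" unfolding frame_cond.simps by blast
  qed simp
  show "Ax4 \<in> X" if X: "AxB \<in> X" "Ax5 \<in> X"
  proof (rule ent)
    fix W :: "nat set" and R
    assume "\<forall>\<sigma>\<in>X. frame_cond \<sigma> W R"
    then have "frame_cond AxB W R" "frame_cond Ax5 W R" using X by blast+
    then show "frame_cond Ax4 W R" unfolding frame_cond.simps by blast
  qed simp
  show "Ax4 \<in> X" if X: "AxT \<in> X" "Ax5 \<in> X"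
  proof (rule ent)
    fix W :: "nat set" and R
    assume "\<forall>\<sigma>\<in>X. frame_cond \<sigma> W R"
    then have "frame_cond AxT W R" "frame_cond Ax5 W R" using X by blast+
    then show "frame_cond Ax4 W R" unfolding frame_cond.simps by blast
  qed simp
qed

text \<open>
  \<open>Q \<sigma> A\<close> stands for a diamond of \<open>A\<close> at \<open>\<sigma>\<close>, and \<open>P \<sigma> A\<close> for \<open>A\<close> being dealt
  with at \<open>\<sigma>\<close>. The local rules reach the whole \<open>X\<close>-closure of the child relation only
  because \<open>X\<close> is 45-closed. A leaf carries no diamond when \<open>AxD \<in> X\<close>, so seriality can
  be restored by loops at leaves.
\<close>

lemma tree_frame:
  fixes N :: "nat list set" and P Q :: "nat list \<Rightarrow> 'b \<Rightarrow> bool"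
  assumes X: "closed45 X"
    and root: "[] \<in> N" and pre: "\<And>\<sigma> c. \<sigma> @ [c] \<in> N \<Longrightarrow> \<sigma> \<in> N"
    and k: "\<And>\<sigma> c A. \<sigma> @ [c] \<in> N \<Longrightarrow> Q \<sigma> A \<Longrightarrow> P (\<sigma> @ [c]) A"
    and d: "\<And>\<sigma> A. AxD \<in> X \<Longrightarrow> \<sigma> \<in> N \<Longrightarrow> Q \<sigma> A \<Longrightarrow> \<exists>c. \<sigma> @ [c] \<in> N"
    and t: "\<And>\<sigma> A. AxT \<in> X \<Longrightarrow> \<sigma> \<in> N \<Longrightarrow> Q \<sigma> A \<Longrightarrow> P \<sigma> A"
    and b: "\<And>\<sigma> c A. AxB \<in> X \<Longrightarrow> \<sigma> @ [c] \<in> N \<Longrightarrow> Q (\<sigma> @ [c]) A \<Longrightarrow> P \<sigma> A"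
    and four: "\<And>\<sigma> c A. Ax4 \<in> X \<Longrightarrow> \<sigma> @ [c] \<in> N \<Longrightarrow> Q \<sigma> A \<Longrightarrow> Q (\<sigma> @ [c]) A"
    and five: "\<And>\<sigma> \<tau> A. Ax5 \<in> X \<Longrightarrow> \<sigma> \<noteq> [] \<Longrightarrow> \<sigma> \<in> N \<Longrightarrow> \<tau> \<in> N \<Longrightarrow> Q \<sigma> A \<Longrightarrow> Q \<tau> A"
  obtains R where "frame N R" "\<forall>\<rho>\<in>X. frame_cond \<rho> N R"
    "\<And>\<sigma> c. \<sigma> @ [c] \<in> N \<Longrightarrow> (\<sigma>, \<sigma> @ [c]) \<in> R"
    "\<And>\<sigma> \<tau> A. (\<sigma>, \<tau>) \<in> R \<Longrightarrow> Q \<sigma> A \<Longrightarrow> P \<tau> A"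
proof -
  define leaf where "leaf \<sigma> \<longleftrightarrow> AxD \<in> X \<and> \<sigma> \<in> N \<and> (\<forall>c. \<sigma> @ [c] \<notin> N)" for \<sigma>
  have leafQ: "\<not> Q \<sigma> A" if "leaf \<sigma>" for \<sigma> A
    using that d unfolding leaf_def by blast
  have prefix: "\<sigma> \<in> N" if "\<sigma> @ \<rho> \<in> N" for \<sigma> \<rho>
    using that by (induction \<rho> rule: rev_induct) (auto intro: pre simp flip: append_assoc)
  have Q4: "Q (\<sigma> @ \<rho>) A" if "Ax4 \<in> X" "\<sigma> @ \<rho> \<in> N" "Q \<sigma> A" for \<sigma> \<rho> A
    using that
  proof (induction \<rho> rule: rev_induct)
    case (snoc c \<rho>)
    then show ?case using four[of "\<sigma> @ \<rho>" c A] prefix[of "\<sigma> @ \<rho>" "[c]"] by simp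
  qed simp
  \<comment> \<open>First the diamond travels to the parent of the target, then \<open>k\<close>
    makes the last step; \<open>P5\<close> does the same with rule 5.\<close>
  have P4: "P (\<sigma> @ \<rho>) A" if "Ax4 \<in> X" "\<sigma> @ \<rho> \<in> N" "Q \<sigma> A" "\<rho> \<noteq> []" for \<sigma> \<rho> A
  proof -
    obtain \<rho>' c where \<rho>: "\<rho> = \<rho>' @ [c]" using \<open>\<rho> \<noteq> []\<close> by (cases \<rho> rule: rev_cases) auto
    then have "Q (\<sigma> @ \<rho>') A" using Q4 that prefix[of "\<sigma> @ \<rho>'" "[c]"] by simp
    then show ?thesis using k[of "\<sigma> @ \<rho>'" c A] that \<rho> by simp
  qed
  have P5: "P \<tau> A" if "Ax5 \<in> X" "\<sigma> \<noteq> []" "\<sigma> \<in> N" "\<tau> \<in> N" "\<tau> \<noteq> []" "Q \<sigma> A" for \<sigma> \<tau> A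
  proof -
    obtain \<tau>' c where \<tau>: "\<tau> = \<tau>' @ [c]" using \<open>\<tau> \<noteq> []\<close> by (cases \<tau> rule: rev_cases) auto
    then show ?thesis using five[OF that(1-3), of \<tau>' A] k[of \<tau>' c A] pre that by simp
  qed
  \<comment> \<open>Without 4 and 5, the relation consists of the child steps, also reversed for b,
    with loops for t and at leaves. With 4 but not 5, closure excludes b and the relation is the
    descendant order with the same loops. With 5, all nodes other than the root form a
    cluster.\<close>
  consider "Ax4 \<notin> X" "Ax5 \<notin> X" | "Ax4 \<in> X" "Ax5 \<notin> X" | "Ax5 \<in> X" by blast
  then show ?thesis
  proof cases
    case 1
    define R where "R = {(\<sigma>, \<tau>). \<sigma> \<in> N \<and> \<tau> \<in> N \<and> ((\<exists>c. \<tau> = \<sigma> @ [c]) \<or>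
      (AxB \<in> X \<and> (\<exists>c. \<sigma> = \<tau> @ [c])) \<or> (AxT \<in> X \<and> \<sigma> = \<tau>) \<or> (leaf \<sigma> \<and> \<sigma> = \<tau>))}"
    show ?thesis
    proof (rule that[of R])
      show "frame N R" using root by (auto simp: frame_def R_def)
      show "\<forall>\<rho>\<in>X. frame_cond \<rho> N R"
      proof
        fix \<rho> assume "\<rho> \<in> X"
        then show "frame_cond \<rho> N R" using 1
        proof (cases \<rho>)
          case AxD
          have "\<exists>\<tau>\<in>N. (\<sigma>, \<tau>) \<in> R" if "\<sigma> \<in> N" for \<sigma>
          proof (cases "leaf \<sigma>")
            case True
            then show ?thesis using that by (auto simp: R_def)
          next
            case False
            then obtain c where "\<sigma> @ [c] \<in> N" using \<open>\<sigma> \<in> N\<close> \<open>\<rho> \<in> X\<close> AxD by (auto simp: leaf_def)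
            then show ?thesis using that by (auto simp: R_def)
          qed
          then show ?thesis using AxD by simp
        qed (auto simp: R_def)
      qed
      show "(\<sigma>, \<sigma> @ [c]) \<in> R" if "\<sigma> @ [c] \<in> N" for \<sigma> c using that pre by (auto simp: R_def)
      show "P \<tau> A" if "(\<sigma>, \<tau>) \<in> R" "Q \<sigma> A" for \<sigma> \<tau> A
        using that k b t leafQ by (auto simp: R_def)
    qed
  next
    case 2
    then have noB: "AxB \<notin> X" using closed45D[OF X] by blast
    define R where "R = {(\<sigma>, \<tau>). \<sigma> \<in> N \<and> \<tau> \<in> N \<and>
      (\<exists>\<rho>. \<tau> = \<sigma> @ \<rho> \<and> (\<rho> \<noteq> [] \<or> AxT \<in> X \<or> leaf \<sigma>))}"
    show ?thesis
    proof (rule that[of R])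
      show "frame N R" using root by (auto simp: frame_def R_def)
      show "\<forall>\<rho>\<in>X. frame_cond \<rho> N R"
      proof
        fix \<rho> assume "\<rho> \<in> X"
        then show "frame_cond \<rho> N R" using 2 noB
        proof (cases \<rho>)
          case AxD
          have "\<exists>\<tau>\<in>N. (\<sigma>, \<tau>) \<in> R" if "\<sigma> \<in> N" for \<sigma>
          proof (cases "leaf \<sigma>")
            case True
            then show ?thesis using that by (auto simp: R_def)
          next
            case False
            then obtain c where "\<sigma> @ [c] \<in> N" using \<open>\<sigma> \<in> N\<close> \<open>\<rho> \<in> X\<close> AxD by (auto simp: leaf_def)
            then show ?thesis using that by (auto simp: R_def)
          qed
          then show ?thesis using AxD by simp
        qed (auto simp: R_def)
      qed
      show "(\<sigma>, \<sigma> @ [c]) \<in> R" if "\<sigma> @ [c] \<in> N" for \<sigma> c using that pre by (auto simp: R_def)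
      show "P \<tau> A" if "(\<sigma>, \<tau>) \<in> R" "Q \<sigma> A" for \<sigma> \<tau> A
        using that P4[OF 2(1)] t leafQ by (auto simp: R_def) (metis append_Nil2)
    qed
  next
    case 3
    have cl: "AxT \<in> X \<or> AxB \<in> X \<Longrightarrow> Ax4 \<in> X" using closed45D[OF X] 3 by blast
    \<comment> \<open>The root joins the cluster when it must be seen: by reflexivity, by symmetry
      once it has a child, or by seriality when it is the only node. Otherwise, without 4, it sees
      only its children.\<close>
    define univ where "univ \<longleftrightarrow> AxT \<in> X \<or> (AxB \<in> X \<and> N \<noteq> {[]}) \<or> (AxD \<in> X \<and> N = {[]})"
    define R where "R = {(\<sigma>, \<tau>). \<sigma> \<in> N \<and> \<tau> \<in> N \<and>
      (univ \<or> \<tau> \<noteq> [] \<and> (\<sigma> \<noteq> [] \<or> Ax4 \<in> X \<or> length \<tau> = 1))}"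
    have child: "\<exists>c. [c] \<in> N" if "N \<noteq> {[]}"
    proof -
      obtain \<sigma> where "\<sigma> \<in> N" "\<sigma> \<noteq> []" using \<open>N \<noteq> {[]}\<close> root by blast
      then obtain c \<rho> where "[c] @ \<rho> \<in> N" by (cases \<sigma>) auto
      then show ?thesis using prefix by blast
    qed
    show ?thesis
    proof (rule that[of R])
      show "frame N R" using root by (auto simp: frame_def R_def)
      show "\<forall>\<rho>\<in>X. frame_cond \<rho> N R"
      proof
        fix \<rho> assume "\<rho> \<in> X"
        show "frame_cond \<rho> N R"
        proof (cases \<rho>)
          case AxD
          show ?thesis
          proof (cases "N = {[]}")
            case True
            then show ?thesis using AxD \<open>\<rho> \<in> X\<close> by (auto simp: R_def univ_def)
          next
            case False
            then show ?thesis using AxD child by (fastforce simp: R_def)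
          qed
        next
          case AxB
          then show ?thesis using \<open>\<rho> \<in> X\<close> by (auto simp: R_def univ_def)
        qed (use \<open>\<rho> \<in> X\<close> in \<open>auto simp: R_def univ_def\<close>)
      qed
      show "(\<sigma>, \<sigma> @ [c]) \<in> R" if "\<sigma> @ [c] \<in> N" for \<sigma> c using that pre by (auto simp: R_def)
      show "P \<tau> A" if R: "(\<sigma>, \<tau>) \<in> R" and Q: "Q \<sigma> A" for \<sigma> \<tau> A
      proof -
        have N: "\<sigma> \<in> N" "\<tau> \<in> N" using R by (auto simp: R_def)
        have Q45: "Q \<upsilon> A" if "Ax4 \<in> X" "\<upsilon> \<in> N" for \<upsilon>
          using five[OF 3 _ N(1) that(2) Q] Q4[of "[]" \<upsilon> A] that Q by (cases "\<sigma> = []") auto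
        show ?thesis
        proof (cases "\<tau> = []")
          case False
          show ?thesis
          proof (cases "\<sigma> = []")
            case True
            consider "Ax4 \<in> X" | "length \<tau> = 1" | "AxD \<in> X" "N = {[]}"
              using R True False cl by (auto simp: R_def univ_def)
            then show ?thesis
            proof cases
              case 1
              then show ?thesis using P4[of "[]" \<tau> A] N Q True False by simp
            next
              case 2
              then show ?thesis using k[of "[]"] N Q True by (auto simp: length_Suc_conv)
            qed (use N False in auto)
          qed (use P5[OF 3] N Q False in auto)
        next
          case True
          then have univ using R by (auto simp: R_def)
          \<comment> \<open>To reach the root: with t the diamond is copied there, with b it is
            copied to a child and its body sent back up, and with d a diamond at a lone root would
            demand a child.\<close>
          then consider "AxT \<in> X" | "AxB \<in> X" "N \<noteq> {[]}" | "AxD \<in> X" "N = {[]}"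
            by (auto simp: univ_def)
          then show ?thesis
          proof cases
            case 1
            then show ?thesis using t N Q45 cl by blast
          next
            case 2
            then obtain c where "[c] \<in> N" using child by blast
            then show ?thesis using b[of "[]" c A] Q45 cl 2 True by auto
          next
            case 3
            then show ?thesis using d[of "[]"] root N Q by auto
          qed
        qed
      qed
    qed
  qed
qed

section \<open>Labelled trees\<close>

text \<open>
  A tree whose nodes are labelled by lists is given by its labelled formulas; an entry
  \<open>(\<sigma>, None)\<close> only records the presence of the node \<open>\<sigma>\<close>.
\<close>

type_synonym 'a tree = "(nat list \<times> 'a fm option) set"

definition shift :: "nat list \<Rightarrow> 'a tree \<Rightarrow> 'a tree" where
  "shift \<sigma> F = {(\<rho>, x). (\<sigma> @ \<rho>, x) \<in> F}"

definition graft :: "nat list \<Rightarrow> 'a tree \<Rightarrow> 'a tree" where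
  "graft \<sigma> G = (\<lambda>(\<rho>, x). (\<sigma> @ \<rho>, x)) ` G"

text \<open>Any entry at or below a label counts, so the nodes of an arbitrary set of entries are
  closed under prefixes.\<close>

definition node :: "'a tree \<Rightarrow> nat list \<Rightarrow> bool" where
  "node F \<sigma> \<longleftrightarrow> shift \<sigma> F \<noteq> {}"

lemma shift_simps [simp]:
  "shift [] F = F"
  "shift \<sigma> (shift \<tau> F) = shift (\<tau> @ \<sigma>) F"
  "shift \<sigma> (F \<union> G) = shift \<sigma> F \<union> shift \<sigma> G"
  "shift \<sigma> (graft \<sigma> G) = G"
  "(\<rho>, x) \<in> shift \<sigma> F \<longleftrightarrow> (\<sigma> @ \<rho>, x) \<in> F"
  by (auto simp: shift_def graft_def)

lemma shift_graft_Cons: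
  "shift [c] (graft [c'] G) = (if c = c' then G else {})"
  by (auto simp: shift_def graft_def)

lemma node_iff: "node F \<sigma> \<longleftrightarrow> (\<exists>\<rho> x. (\<sigma> @ \<rho>, x) \<in> F)"
  by (auto simp: node_def shift_def)

lemma node_mono: "node F \<sigma> \<Longrightarrow> F \<subseteq> F' \<Longrightarrow> node F' \<sigma>"
  by (auto simp: node_iff)

lemma node_prefix: "node F (\<sigma> @ \<tau>) \<Longrightarrow> node F \<sigma>"
  by (auto simp: node_iff)

lemma node_shift: "node (shift \<sigma> F) \<tau> \<longleftrightarrow> node F (\<sigma> @ \<tau>)"
  by (simp add: node_def)

lemma node_entry: "(\<sigma>, x) \<in> F \<Longrightarrow> node F \<sigma>"
  unfolding node_iff by (metis append_Nil2)

section \<open>Homomorphisms from labelled trees to sequents\<close>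

text \<open>
  \<open>embeds F \<Gamma>\<close>: there is a homomorphism, possibly identifying nodes, from \<open>F\<close> to \<open>\<Gamma>\<close>.
\<close>

inductive embeds :: "'a tree \<Rightarrow> 'a nseq \<Rightarrow> bool" where
  "(\<And>A. ([], Some A) \<in> F \<Longrightarrow> Fm A \<in># \<Gamma>) \<Longrightarrow>
   (\<And>c. shift [c] F \<noteq> {} \<Longrightarrow> \<exists>\<Delta>. Br \<Delta> \<in># \<Gamma> \<and> embeds (shift [c] F) \<Delta>) \<Longrightarrow>
   embeds F \<Gamma>"

lemma embeds_iff:
  "embeds F \<Gamma> \<longleftrightarrow> (\<forall>A. ([], Some A) \<in> F \<longrightarrow> Fm A \<in># \<Gamma>) \<and>
    (\<forall>c. shift [c] F \<noteq> {} \<longrightarrow> (\<exists>\<Delta>. Br \<Delta> \<in># \<Gamma> \<and> embeds (shift [c] F) \<Delta>))"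
  by (subst embeds.simps) auto

text \<open>No embedding is lost when \<Pi> grows to \<Pi>'. Multiplicities are ignored, and boxes
  are compared by the trees they accommodate, which avoids a recursion on sequents.\<close>

definition leq :: "'a nseq \<Rightarrow> 'a nseq \<Rightarrow> bool" where
  "leq \<Pi> \<Pi>' \<longleftrightarrow> (\<forall>A. Fm A \<in># \<Pi> \<longrightarrow> Fm A \<in># \<Pi>') \<and>
    (\<forall>\<Delta>. Br \<Delta> \<in># \<Pi> \<longrightarrow> (\<exists>\<Delta>'. Br \<Delta>' \<in># \<Pi>' \<and> (\<forall>F. embeds F \<Delta> \<longrightarrow> embeds F \<Delta>')))"

lemma leq_embeds: "leq \<Pi> \<Pi>' \<Longrightarrow> embeds F \<Pi> \<Longrightarrow> embeds F \<Pi>'"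
  unfolding leq_def by (subst (asm) embeds_iff, subst embeds_iff) meson

lemma leq_union: "leq \<Pi> (\<Pi> + \<Sigma>)"
  unfolding leq_def by auto

lemma leq_fill: "leq \<Pi> \<Pi>' \<Longrightarrow> leq (fill C \<Pi>) (fill C \<Pi>')"
proof (induction C)
  case (Hole \<Delta>)
  then show ?case unfolding leq_def by auto
next
  case (Under \<Delta> C)
  then show ?case using leq_embeds unfolding leq_def[of "fill (Under \<Delta> C) _"] by auto
qed

text \<open>
  \<open>located F \<sigma> C \<Pi>\<close>: some embedding of \<open>F\<close> in \<open>fill C \<Pi>\<close> sends \<open>\<sigma>\<close> to the hole, and
  it survives growth of \<open>F\<close> at \<open>\<sigma>\<close> together with growth of \<open>\<Pi>\<close>.
\<close>

definition located :: "'a tree \<Rightarrow> nat list \<Rightarrow> 'a ctx \<Rightarrow> 'a nseq \<Rightarrow> bool" where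
  "located F \<sigma> C \<Pi> \<longleftrightarrow> embeds (shift \<sigma> F) \<Pi> \<and>
    (\<forall>G \<Pi>'. leq \<Pi> \<Pi>' \<longrightarrow> embeds (shift \<sigma> F \<union> G) \<Pi>' \<longrightarrow>
      embeds (F \<union> graft \<sigma> G) (fill C \<Pi>'))"

lemma located_Nil: "embeds F \<Gamma> \<Longrightarrow> located F [] (Hole {#}) \<Gamma>"
  by (auto simp: located_def graft_def)

lemma graft_append: "graft (\<sigma> @ \<tau>) G = graft \<sigma> (graft \<tau> G)"
  by (force simp: graft_def)

lemma located_comp:
  assumes "located F \<sigma> C (fill D \<Pi>)" "located (shift \<sigma> F) \<tau> D \<Pi>"
  shows "located F (\<sigma> @ \<tau>) (ctx_comp C D) \<Pi>"
  using assms unfolding located_def by (auto simp: graft_append leq_fill)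

lemma located_child:
  assumes "embeds F \<Gamma>" "shift [c] F \<noteq> {}"
  obtains \<Gamma>' \<Delta> where "\<Gamma> = add_mset (Br \<Delta>) \<Gamma>'" "located F [c] (Under \<Gamma>' (Hole {#})) \<Delta>"
proof -
  from assms obtain \<Delta> where "Br \<Delta> \<in># \<Gamma>" and \<Delta>: "embeds (shift [c] F) \<Delta>"
    by (subst (asm) embeds_iff) blast
  then obtain \<Gamma>' where \<Gamma>: "\<Gamma> = add_mset (Br \<Delta>) \<Gamma>'" by (auto dest: multi_member_split)
  have "embeds (F \<union> graft [c] G) (add_mset (Br \<Delta>') \<Gamma>')"
    if leq: "leq \<Delta> \<Delta>'" and emb: "embeds (shift [c] F \<union> G) \<Delta>'" for G \<Delta>'
  proof (subst embeds_iff, intro conjI allI impI)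
    fix A
    assume "([], Some A) \<in> F \<union> graft [c] G"
    then have "([], Some A) \<in> F" by (auto simp: graft_def)
    then have "Fm A \<in># \<Gamma>" using assms(1) by (subst (asm) embeds_iff) blast
    then show "Fm A \<in># add_mset (Br \<Delta>') \<Gamma>'" by (simp add: \<Gamma>)
  next
    fix c'
    assume c': "shift [c'] (F \<union> graft [c] G) \<noteq> {}"
    show "\<exists>\<Theta>. Br \<Theta> \<in># add_mset (Br \<Delta>') \<Gamma>' \<and> embeds (shift [c'] (F \<union> graft [c] G)) \<Theta>"
    proof (cases "c' = c")
      case True
      then show ?thesis using emb by auto
    next
      case False
      then have eq: "shift [c'] (F \<union> graft [c] G) = shift [c'] F" by (simp add: shift_graft_Cons)
      have "shift [c'] F \<noteq> {}" using c' unfolding eq .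
      with assms(1) obtain \<Theta> where \<Theta>: "Br \<Theta> \<in># \<Gamma>" "embeds (shift [c'] F) \<Theta>"
        by (subst (asm) embeds_iff) blast
      \<comment> \<open>Another child may share the image \<Delta> of \<open>c\<close>; it then
        moves along to \<Delta>', as \<open>leq\<close> permits.\<close>
      then show ?thesis using leq_embeds[OF leq] unfolding eq \<Gamma> by auto
    qed
  qed
  then have "located F [c] (Under \<Gamma>' (Hole {#})) \<Delta>" using \<Delta> by (auto simp: located_def)
  then show ?thesis using \<Gamma> that by blast
qed

text \<open>The boxes that an embedding traverses along \<sigma> are peeled off one by one. The
  depth is recorded for the side condition of rule 5.\<close>

lemma locate:
  assumes "embeds F \<Gamma>" "node F \<sigma>"
  obtains C \<Pi> where "\<Gamma> = fill C \<Pi>" "depth C = length \<sigma>" "located F \<sigma> C \<Pi>"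
  using assms
proof (induction \<sigma> arbitrary: F \<Gamma> thesis)
  case Nil
  show ?case
    by (rule Nil(1)[of "Hole {#}" \<Gamma>]) (simp_all add: located_Nil Nil(2))
next
  case (Cons c \<sigma>)
  have "shift [c] F \<noteq> {}" using node_prefix[of F "[c]" \<sigma>] Cons.prems(3) by (simp add: node_def)
  then obtain \<Gamma>' \<Delta> where \<Delta>: "\<Gamma> = add_mset (Br \<Delta>) \<Gamma>'"
    "located F [c] (Under \<Gamma>' (Hole {#})) \<Delta>"
    using located_child Cons.prems(2) by blast
  then have "embeds (shift [c] F) \<Delta>" "node (shift [c] F) \<sigma>"
    using Cons.prems(3) by (auto simp: located_def node_shift)
  from Cons.IH[OF _ this] obtain D \<Pi> where D: "\<Delta> = fill D \<Pi>" "depth D = length \<sigma>"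
    "located (shift [c] F) \<sigma> D \<Pi>" by blast
  then have "located F (c # \<sigma>) (ctx_comp (Under \<Gamma>' (Hole {#})) D) \<Pi>"
    using located_comp[of F "[c]" "Under \<Gamma>' (Hole {#})" D \<Pi> \<sigma>] \<Delta>(2) by simp
  then show ?case
    by (rule Cons.prems(1)[rotated -1]) (auto simp: \<Delta> D fill_add_ctx)
qed

lemma located_Fm: "located F \<sigma> C \<Pi> \<Longrightarrow> (\<sigma>, Some A) \<in> F \<Longrightarrow> Fm A \<in># \<Pi>"
  unfolding located_def by (subst (asm) embeds_iff) auto

text \<open>Rules k, 4 and b act across a box, so parent and child must be located along one and the
  same box.\<close>

lemma locate_child:
  assumes "embeds F \<Gamma>" "node F (\<sigma> @ [c])"
  obtains C \<Pi> \<Delta> where "\<Gamma> = fill C (add_mset (Br \<Delta>) \<Pi>)" "depth C = length \<sigma>"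
    "located F \<sigma> C (add_mset (Br \<Delta>) \<Pi>)"
    "located F (\<sigma> @ [c]) (ctx_comp C (Under \<Pi> (Hole {#}))) \<Delta>"
proof -
  obtain C \<Pi> where C: "\<Gamma> = fill C \<Pi>" "depth C = length \<sigma>" "located F \<sigma> C \<Pi>"
    using locate assms node_prefix by metis
  have "embeds (shift \<sigma> F) \<Pi>" "shift [c] (shift \<sigma> F) \<noteq> {}"
    using C(3) assms(2) by (auto simp: located_def node_def)
  then obtain \<Pi>' \<Delta> where \<Delta>: "\<Pi> = add_mset (Br \<Delta>) \<Pi>'"
    "located (shift \<sigma> F) [c] (Under \<Pi>' (Hole {#})) \<Delta>" by (rule located_child)
  then have "located F (\<sigma> @ [c]) (ctx_comp C (Under \<Pi>' (Hole {#}))) \<Delta>"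
    using located_comp[OF _ \<Delta>(2)] C(3) by simp
  then show ?thesis using that C \<Delta> by blast
qed

section \<open>Trees that represent a given sequent\<close>

text \<open>The empty tree embeds in every sequent, so embeddings alone never show that something
  has been entered. Covering is the reverse demand: each item is matched in the tree, boxes by
  actual child nodes.\<close>

primrec covers_item :: "'a tree \<Rightarrow> 'a item \<Rightarrow> nat list \<Rightarrow> bool" where
  "covers_item F (Fm A) = (\<lambda>\<sigma>. (\<sigma>, Some A) \<in> F)"
| "covers_item F (Br \<Delta>) =
    (\<lambda>\<sigma>. \<exists>c. node F (\<sigma> @ [c]) \<and> (\<forall>f\<in>#image_mset (covers_item F) \<Delta>. f (\<sigma> @ [c])))"

definition covers :: "'a tree \<Rightarrow> nat list \<Rightarrow> 'a nseq \<Rightarrow> bool" where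
  "covers F \<sigma> \<Gamma> \<longleftrightarrow> (\<forall>i\<in>#\<Gamma>. covers_item F i \<sigma>)"

lemma covers_simps [simp]:
  "covers F \<sigma> {#}"
  "covers F \<sigma> (add_mset i \<Gamma>) \<longleftrightarrow> covers_item F i \<sigma> \<and> covers F \<sigma> \<Gamma>"
  "covers_item F (Br \<Delta>) \<sigma> \<longleftrightarrow> (\<exists>c. node F (\<sigma> @ [c]) \<and> covers F (\<sigma> @ [c]) \<Delta>)"
  by (auto simp: covers_def)

declare covers_item.simps(2) [simp del]

lemma covers_item_graft:
  "covers_item G i \<tau> \<Longrightarrow> graft \<sigma> G \<subseteq> F \<Longrightarrow> covers_item F i (\<sigma> @ \<tau>)"
proof (induction i arbitrary: \<tau>)
  case (Fm A)
  then show ?case by (force simp: graft_def)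
next
  case (Br \<Delta>)
  then obtain c where c: "node G (\<tau> @ [c])" "covers G (\<tau> @ [c]) \<Delta>" by auto
  then have "node F ((\<sigma> @ \<tau>) @ [c])"
    using Br.prems(2) by (fastforce simp: node_iff graft_def)
  moreover have "covers F ((\<sigma> @ \<tau>) @ [c]) \<Delta>"
    using c(2) Br.IH[of _ "\<tau> @ [c]"] Br.prems(2) by (auto simp: covers_def)
  ultimately show ?case by auto
qed

lemma covers_graft: "covers G [] \<Gamma> \<Longrightarrow> graft \<sigma> G \<subseteq> F \<Longrightarrow> covers F \<sigma> \<Gamma>"
  using covers_item_graft[of G _ "[]" \<sigma> F] by (auto simp: covers_def)

lemma covers_mono: "covers F \<sigma> \<Gamma> \<Longrightarrow> F \<subseteq> F' \<Longrightarrow> covers F' \<sigma> \<Gamma>"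
proof -
  have "covers_item F i \<sigma> \<Longrightarrow> F \<subseteq> F' \<Longrightarrow> covers_item F' i \<sigma>" for i
    using covers_item_graft[of F i \<sigma> "[]" F'] by (simp add: graft_def)
  then show "covers F \<sigma> \<Gamma> \<Longrightarrow> F \<subseteq> F' \<Longrightarrow> covers F' \<sigma> \<Gamma>" by (auto simp: covers_def)
qed

lemma embeds_union:
  assumes "embeds F \<Gamma>" "embeds G \<Delta>" "\<And>c. shift [c] F = {} \<or> shift [c] G = {}"
  shows "embeds (F \<union> G) (\<Gamma> + \<Delta>)"
proof (subst embeds_iff, intro conjI allI impI)
  show "Fm A \<in># \<Gamma> + \<Delta>" if "([], Some A) \<in> F \<union> G" for A
    using that assms(1,2) by (subst (asm) (1 2) embeds_iff) auto
  show "\<exists>\<Theta>. Br \<Theta> \<in># \<Gamma> + \<Delta> \<and> embeds (shift [c] (F \<union> G)) \<Theta>" if c: "shift [c] (F \<union> G) \<noteq> {}" for c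
  proof (cases "shift [c] F = {}")
    case True
    then show ?thesis using c assms(2) by (subst (asm) embeds_iff) auto
  next
    case False
    then show ?thesis using c assms(3)[of c] assms(1) by (subst (asm) embeds_iff) auto
  qed
qed

lemma finite_children:
  assumes "finite F"
  shows "\<exists>N. \<forall>c. shift [c] F \<noteq> {} \<longrightarrow> c < N"
proof -
  have "c \<in> (\<lambda>(\<rho>, x). hd \<rho>) ` F" if "shift [c] F \<noteq> {}" for c
    using that by (force simp: shift_def)
  moreover obtain N where "\<forall>c\<in>(\<lambda>(\<rho>, x). hd \<rho>) ` F. c < N"
    using assms finite_nat_set_iff_bounded by blast
  ultimately show ?thesis by blast
qed

text \<open>The labels of \<open>G\<close> can be chosen above any \<open>N\<close>, so that \<open>G\<close> can be grafted as fresh nodes.\<close>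

definition represents :: "nat \<Rightarrow> 'a tree \<Rightarrow> 'a nseq \<Rightarrow> bool" where
  "represents N G \<Gamma> \<longleftrightarrow> finite G \<and> G \<noteq> {} \<and> embeds G \<Gamma> \<and> covers G [] \<Gamma> \<and>
    (\<forall>c. shift [c] G \<noteq> {} \<longrightarrow> N \<le> c) \<and>
    (\<forall>P. all_fm P \<Gamma> \<longrightarrow> (\<forall>\<sigma> A. (\<sigma>, Some A) \<in> G \<longrightarrow> P A))"

text \<open>Items are entered one at a time with child labels above those in use, so that distinct
  boxes never merge into one node.\<close>

lemma representation_exists: "\<exists>G. represents N G \<Gamma>"
proof -
  \<comment> \<open>The \<open>None\<close> entry keeps the representation nonempty, so that an
    empty box still gives a node.\<close>
  have emptyI: "represents N {([], None)} {#}" for N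
  proof -
    have "embeds {([], None)} {#}" by (rule embeds.intros) (auto simp: shift_def)
    then show ?thesis by (auto simp: represents_def shift_def)
  qed
  have unionI: "represents N (H \<union> G) (\<Gamma> + \<Delta>)"
    if "represents N H \<Gamma>" "represents N G \<Delta>" "\<And>c. shift [c] H = {} \<or> shift [c] G = {}"
    for N H G \<Gamma> \<Delta>
    using that covers_mono[of H "[]" \<Gamma> "H \<union> G"] covers_mono[of G "[]" \<Delta> "H \<union> G"]
    by (auto simp: represents_def embeds_union covers_def)
  have above: "\<exists>N' \<ge> N. \<forall>c. shift [c] H \<noteq> {} \<longrightarrow> c < N'" if "represents N H \<Gamma>" for N H \<Gamma>
  proof -
    obtain M where "\<forall>c. shift [c] H \<noteq> {} \<longrightarrow> c < M"
      using \<open>represents N H \<Gamma>\<close> finite_children[of H] by (auto simp: represents_def)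
    then show ?thesis by (intro exI[of _ "max N M"]) force
  qed
  have mset: "\<exists>G. represents N G \<Gamma>"
    if "\<And>i N. i \<in># \<Gamma> \<Longrightarrow> \<exists>G. represents N G {#i#}" for N \<Gamma>
    using that
  proof (induction \<Gamma>)
    case empty
    show ?case using emptyI by blast
  next
    case (add i \<Gamma>)
    then obtain H where H: "represents N H \<Gamma>" by auto
    from above[OF this] obtain N' where N': "N \<le> N'" "\<And>c. shift [c] H \<noteq> {} \<Longrightarrow> c < N'" by blast
    from add.prems[of i N'] obtain G where G: "represents N' G {#i#}" by auto
    then have "represents N G {#i#}" using N'(1) by (fastforce simp: represents_def)
    moreover have "shift [c] H = {} \<or> shift [c] G = {}" for c
      using N'(2)[of c] G unfolding represents_def by (meson leD)
    ultimately have "represents N (H \<union> G) (\<Gamma> + {#i#})" using H unionI by blast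
    then show ?case by auto
  qed
  have "\<exists>G. represents N G {#i#}" for i N
  proof (induction i arbitrary: N)
    case (Fm A)
    have "represents N {([], Some A)} {#Fm A#}"
    proof -
      have "embeds {([], Some A)} {#Fm A#}" by (rule embeds.intros) (auto simp: shift_def)
      then show ?thesis by (auto simp: represents_def shift_def)
    qed
    then show ?case by blast
  next
    case (Br \<Delta>)
    obtain G where G: "represents 0 G \<Delta>" using mset[OF Br.IH] by blast
    have "embeds (graft [N] G) {#Br \<Delta>#}"
    proof (rule embeds.intros)
      show "Fm A \<in># {#Br \<Delta>#}" if "([], Some A) \<in> graft [N] G" for A
        using that by (auto simp: graft_def)
      show "\<exists>\<Theta>. Br \<Theta> \<in># {#Br \<Delta>#} \<and> embeds (shift [c] (graft [N] G)) \<Theta>"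
        if "shift [c] (graft [N] G) \<noteq> {}" for c
        using that G by (auto simp: represents_def shift_graft_Cons split: if_splits)
    qed
    moreover have "covers (graft [N] G) [N] \<Delta>" "node (graft [N] G) [N]"
      using G covers_graft by (auto simp: represents_def node_def)
    moreover have "all_fm P \<Delta> \<Longrightarrow> (\<sigma>, Some A) \<in> graft [N] G \<Longrightarrow> P A" for P \<sigma> A
      using G by (auto simp: represents_def graft_def)
    moreover have "finite (graft [N] G)" "graft [N] G \<noteq> {}"
      using G by (auto simp: represents_def graft_def)
    moreover have "N \<le> c" if "shift [c] (graft [N] G) \<noteq> {}" for c
      using that by (simp add: shift_graft_Cons split: if_splits)
    moreover have "covers (graft [N] G) [] {#Br \<Delta>#}"
      using calculation(2,3) by (auto intro: exI[of _ N])
    ultimately have "represents N (graft [N] G) {#Br \<Delta>#}"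
      unfolding represents_def all_fm_simps by blast
    then show ?case by blast
  qed
  then show ?thesis using mset by blast
qed

section \<open>Saturation\<close>

text \<open>Embeddings yield two separate unary contexts, whereas rule 5 speaks of one binary
  context. The two paths are followed together and split where they part; equal boxes may be taken
  as the same box.\<close>

lemma two_contexts:
  assumes "fill C {#} = fill D {#Fm B#}"
  obtains E where "\<And>\<Sigma>. fill2 E {#Fm B#} \<Sigma> = fill C \<Sigma>" "depth (fill_snd E {#}) = depth D"
  using assms
proof (induction C arbitrary: D thesis)
  case (Hole \<Delta>)
  show ?case
  proof (rule Hole.prems(1)[of "Split D (Hole {#})"])
    show "fill2 (Split D (Hole {#})) {#Fm B#} \<Sigma> = fill (Hole \<Delta>) \<Sigma>" for \<Sigma>
      using Hole.prems(2) by (simp add: fill2_simps)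
  qed simp
next
  case (Under \<Delta> C)
  show ?case
  proof (cases D)
    case (Hole \<Theta>)
    then obtain \<Delta>' where \<Delta>: "\<Delta> = add_mset (Fm B) \<Delta>'"
      using Under.prems(2) by (auto simp: add_eq_conv_ex)
    show ?thesis
    proof (rule Under.prems(1)[of "Split (Hole \<Delta>') (Under {#} C)"])
      show "fill2 (Split (Hole \<Delta>') (Under {#} C)) {#Fm B#} \<Sigma> = fill (Under \<Delta> C) \<Sigma>" for \<Sigma>
        using \<Delta> by (simp add: fill2_simps)
    qed (simp add: Hole)
  next
    case (Under \<Theta> D')
    with Under.prems(2) consider "\<Delta> = \<Theta>" "fill C {#} = fill D' {#Fm B#}"
      | \<Delta>' where "\<Delta> = add_mset (Br (fill D' {#Fm B#})) \<Delta>'"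
      by (auto simp: add_eq_conv_ex)
    then show ?thesis
    proof cases
      case 1
      from Under.IH[OF _ 1(2)] obtain E where E: "\<And>\<Sigma>. fill2 E {#Fm B#} \<Sigma> = fill C \<Sigma>"
        "depth (fill_snd E {#}) = depth D'" by blast
      show ?thesis
      proof (rule Under.prems(1)[of "Under2 \<Delta> E"])
        show "fill2 (Under2 \<Delta> E) {#Fm B#} \<Sigma> = fill (ctx.Under \<Delta> C) \<Sigma>" for \<Sigma>
          using E by (simp add: fill2_simps)
      qed (simp add: Under E)
    next
      case 2
      show ?thesis
      proof (rule Under.prems(1)[of "Split (ctx.Under \<Delta>' D') (ctx.Under {#} C)"])
        show "fill2 (Split (ctx.Under \<Delta>' D') (ctx.Under {#} C)) {#Fm B#} \<Sigma> =
            fill (ctx.Under \<Delta> C) \<Sigma>" for \<Sigma>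
          using 2 by (simp add: fill2_simps)
      qed (simp add: Under)
    qed
  qed
qed

text \<open>Read upwards, every diamond rule only adds a sequent \<open>\<Sigma>\<close> at some node \<open>\<tau>\<close>.\<close>

inductive required :: "modal_axiom set \<Rightarrow> 'a tree \<Rightarrow> nat list \<Rightarrow> 'a nseq \<Rightarrow> bool"
  for X F where
  k: "(\<sigma>, Some (Dia A)) \<in> F \<Longrightarrow> node F (\<sigma> @ [c]) \<Longrightarrow> required X F (\<sigma> @ [c]) {#Fm A#}"
| d: "AxD \<in> X \<Longrightarrow> (\<sigma>, Some (Dia A)) \<in> F \<Longrightarrow> required X F \<sigma> {#Br {#Fm A#}#}"
| t: "AxT \<in> X \<Longrightarrow> (\<sigma>, Some (Dia A)) \<in> F \<Longrightarrow> required X F \<sigma> {#Fm A#}"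
| b: "AxB \<in> X \<Longrightarrow> (\<sigma> @ [c], Some (Dia A)) \<in> F \<Longrightarrow> required X F \<sigma> {#Fm A#}"
| four: "Ax4 \<in> X \<Longrightarrow> (\<sigma>, Some (Dia A)) \<in> F \<Longrightarrow> node F (\<sigma> @ [c]) \<Longrightarrow>
    required X F (\<sigma> @ [c]) {#Fm (Dia A)#}"
| five: "Ax5 \<in> X \<Longrightarrow> \<sigma> \<noteq> [] \<Longrightarrow> (\<sigma>, Some (Dia A)) \<in> F \<Longrightarrow> node F \<tau> \<Longrightarrow>
    required X F \<tau> {#Fm (Dia A)#}"

lemma required_mono: "required X F \<tau> \<Sigma> \<Longrightarrow> F \<subseteq> F' \<Longrightarrow> required X F' \<tau> \<Sigma>"
  by (induction rule: required.induct) (blast intro: required.intros node_mono)+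

lemma required_node: "required X F \<tau> \<Sigma> \<Longrightarrow> node F \<tau>"
  by (induction rule: required.induct) (blast intro: node_entry node_prefix)+

lemma required_dia:
  "required X F \<tau> \<Sigma> \<Longrightarrow> \<exists>\<sigma> A. (\<sigma>, Some (Dia A)) \<in> F \<and>
    \<Sigma> \<in> {{#Fm A#}, {#Fm (Dia A)#}, {#Br {#Fm A#}#}}"
  by (induction rule: required.induct) blast+

lemma finite_node: "finite F \<Longrightarrow> finite {\<sigma>. node F \<sigma>}"
proof -
  assume "finite F"
  have "{\<sigma>. node F \<sigma>} \<subseteq> (\<Union>(\<rho>, x)\<in>F. (\<lambda>n. take n \<rho>) ` {..length \<rho>})"
  proof
    fix \<sigma> assume "\<sigma> \<in> {\<sigma>. node F \<sigma>}"
    then obtain \<rho> x where "(\<sigma> @ \<rho>, x) \<in> F" by (auto simp: node_iff)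
    then show "\<sigma> \<in> (\<Union>(\<rho>, x)\<in>F. (\<lambda>n. take n \<rho>) ` {..length \<rho>})"
      by (intro UN_I[of "(\<sigma> @ \<rho>, x)"]) (auto intro!: image_eqI[of _ _ "length \<sigma>"])
  qed
  then show ?thesis by (rule finite_subset) (use \<open>finite F\<close> in auto)
qed

text \<open>A diamond asks for at most three sequents, and only at the finitely many nodes.
  Finiteness lets one round discharge all requirements of a stage.\<close>

lemma finite_required:
  assumes "finite F" shows "finite {(\<tau>, \<Sigma>). required X F \<tau> \<Sigma>}"
proof -
  define B where "B = (\<Union>(\<sigma>, x)\<in>F. case x of Some (Dia A) \<Rightarrow>
    {{#Fm A#}, {#Fm (Dia A)#}, {#Br {#Fm A#}#}} | _ \<Rightarrow> {})"
  have "\<Sigma> \<in> B" if "required X F \<tau> \<Sigma>" for \<tau> \<Sigma>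
    using required_dia[OF that] unfolding B_def by fastforce
  then have "{(\<tau>, \<Sigma>). required X F \<tau> \<Sigma>} \<subseteq> {\<sigma>. node F \<sigma>} \<times> B"
    using required_node by auto
  moreover have "finite B"
    unfolding B_def using assms by (auto split: option.split fm.split)
  ultimately show ?thesis using finite_node[OF assms] by (auto intro: finite_subset)
qed

lemma required_rule:
  assumes emb: "embeds F \<Gamma>" and req: "required X F \<tau> \<Sigma>"
  obtains C \<Pi> where "\<Gamma> = fill C \<Pi>" "located F \<tau> C \<Pi>"
    "([fill C (\<Pi> + \<Sigma>)], fill C \<Pi>) \<in> sys_K \<union> dia_rules X"
proof -
  have here: "\<exists>C \<Pi>. \<Gamma> = fill C (add_mset (Fm A) \<Pi>) \<and> depth C = length \<sigma> \<and>
      located F \<sigma> C (add_mset (Fm A) \<Pi>)" if "(\<sigma>, Some A) \<in> F" for \<sigma> A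
  proof -
    from locate[OF emb node_entry[OF that]] obtain C \<Pi>
      where C: "\<Gamma> = fill C \<Pi>" "depth C = length \<sigma>" "located F \<sigma> C \<Pi>" by blast
    with located_Fm[OF C(3) that] show ?thesis by (metis multi_member_split)
  qed
  have to_child: "\<exists>C \<Delta>. \<Gamma> = fill C {#Fm A, Br \<Delta>#} \<and>
      located F (\<sigma> @ [c]) (ctx_comp C (Under {#Fm A#} (Hole {#}))) \<Delta>"
    if A: "(\<sigma>, Some A) \<in> F" and c: "node F (\<sigma> @ [c])" for \<sigma> c A
  proof -
    from locate_child[OF emb c] obtain C \<Pi> \<Delta>
      where C: "\<Gamma> = fill C (add_mset (Br \<Delta>) \<Pi>)" "located F \<sigma> C (add_mset (Br \<Delta>) \<Pi>)"
        "located F (\<sigma> @ [c]) (ctx_comp C (Under \<Pi> (Hole {#}))) \<Delta>" by blast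
    obtain \<Pi>' where \<Pi>: "\<Pi> = add_mset (Fm A) \<Pi>'"
      using located_Fm[OF C(2) A] by (auto dest: multi_member_split)
    have "located F (\<sigma> @ [c]) (ctx_comp (ctx_comp C (Hole \<Pi>')) (Under {#Fm A#} (Hole {#}))) \<Delta>"
      using C(3) by (auto simp: located_def \<Pi>)
    moreover have "\<Gamma> = fill (ctx_comp C (Hole \<Pi>')) {#Fm A, Br \<Delta>#}"
      by (simp add: C(1) \<Pi> add_mset_commute)
    ultimately show ?thesis by blast
  qed
  have dia: "i \<in> sys_K \<union> dia_rules X" if "\<rho> \<in> X" "i \<in> dia_rule \<rho>" for i :: "'a nseq list \<times> 'a nseq"
    and \<rho>
    using that by (auto simp: dia_rules_def)
  from req show ?thesis
  proof cases
    case (k \<sigma> A c)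
    from to_child[OF k(3,4)] obtain C \<Delta> where C: "\<Gamma> = fill C {#Fm (Dia A), Br \<Delta>#}"
      "located F (\<sigma> @ [c]) (ctx_comp C (Under {#Fm (Dia A)#} (Hole {#}))) \<Delta>" by blast
    have "([fill C {#Fm (Dia A), Br (\<Delta> + {#Fm A#})#}], fill C {#Fm (Dia A), Br \<Delta>#}) \<in> dia_k_rule"
      unfolding dia_k_rule_def by blast
    then show ?thesis
      by (intro that[OF _ C(2)[folded k(1)]]) (simp_all add: C(1) k(2) sys_K_def add_mset_commute)
  next
    case (d A)
    from here[OF d(3)] obtain C \<Pi> where C: "\<Gamma> = fill C (add_mset (Fm (Dia A)) \<Pi>)"
      "located F \<tau> C (add_mset (Fm (Dia A)) \<Pi>)" by blast
    have "([fill (ctx_comp C (Hole \<Pi>)) {#Fm (Dia A), Br {#Fm A#}#}],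
        fill (ctx_comp C (Hole \<Pi>)) {#Fm (Dia A)#}) \<in> dia_rule AxD"
      unfolding dia_rule.simps by blast
    from dia[OF d(2) this] show ?thesis
      by (intro that[OF _ C(2)]) (simp_all add: C(1) d(1) add_mset_commute)
  next
    case (t A)
    from here[OF t(3)] obtain C \<Pi> where C: "\<Gamma> = fill C (add_mset (Fm (Dia A)) \<Pi>)"
      "located F \<tau> C (add_mset (Fm (Dia A)) \<Pi>)" by blast
    have "([fill (ctx_comp C (Hole \<Pi>)) {#Fm (Dia A), Fm A#}],
        fill (ctx_comp C (Hole \<Pi>)) {#Fm (Dia A)#}) \<in> dia_rule AxT"
      unfolding dia_rule.simps by blast
    from dia[OF t(2) this] show ?thesis
      by (intro that[OF _ C(2)]) (simp_all add: C(1) t(1) add_mset_commute)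
  next
    case (b c A)
    from locate_child[OF emb node_entry[OF b(3)]] obtain C \<Pi> \<Delta>
      where C: "\<Gamma> = fill C (add_mset (Br \<Delta>) \<Pi>)" "located F \<tau> C (add_mset (Br \<Delta>) \<Pi>)"
        "located F (\<tau> @ [c]) (ctx_comp C (Under \<Pi> (Hole {#}))) \<Delta>" by blast
    obtain \<Delta>' where \<Delta>: "\<Delta> = \<Delta>' + {#Fm (Dia A)#}"
      using located_Fm[OF C(3) b(3)] by (auto dest: multi_member_split)
    have "([fill (ctx_comp C (Hole \<Pi>)) {#Br (\<Delta>' + {#Fm (Dia A)#}), Fm A#}],
        fill (ctx_comp C (Hole \<Pi>)) {#Br (\<Delta>' + {#Fm (Dia A)#})#}) \<in> dia_rule AxB"
      unfolding dia_rule.simps by blast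
    from dia[OF b(2) this] show ?thesis
      by (intro that[OF _ C(2)]) (simp_all add: C(1) b(1) \<Delta> add_mset_commute)
  next
    case (four \<sigma> A c)
    from to_child[OF four(4,5)] obtain C \<Delta> where C: "\<Gamma> = fill C {#Fm (Dia A), Br \<Delta>#}"
      "located F (\<sigma> @ [c]) (ctx_comp C (Under {#Fm (Dia A)#} (Hole {#}))) \<Delta>" by blast
    have "([fill C {#Fm (Dia A), Br (\<Delta> + {#Fm (Dia A)#})#}],
        fill C {#Fm (Dia A), Br \<Delta>#}) \<in> dia_rule Ax4"
      unfolding dia_rule.simps by blast
    from dia[OF four(3) this] show ?thesis
      by (intro that[OF _ C(2)[folded four(1)]]) (simp_all add: C(1) four(2) add_mset_commute)
  next
    case (five \<sigma> A)
    from locate[OF emb five(5)] obtain C \<Pi> where C: "\<Gamma> = fill C \<Pi>" "located F \<tau> C \<Pi>" by blast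
    from here[OF five(4)] obtain D \<Theta> where D: "\<Gamma> = fill D (add_mset (Fm (Dia A)) \<Theta>)"
      "depth D = length \<sigma>" by blast
    have "fill (ctx_comp C (Hole \<Pi>)) {#} = fill (ctx_comp D (Hole \<Theta>)) {#Fm (Dia A)#}"
      using C D by simp
    then obtain E where E: "\<And>\<Sigma>. fill2 E {#Fm (Dia A)#} \<Sigma> = fill (ctx_comp C (Hole \<Pi>)) \<Sigma>"
      "depth (fill_snd E {#}) = depth (ctx_comp D (Hole \<Theta>))" by (rule two_contexts) blast
    have "([fill2 E {#Fm (Dia A)#} {#Fm (Dia A)#}], fill2 E {#Fm (Dia A)#} {#}) \<in> dia_rule Ax5"
      using E(2) D(2) five(3) unfolding dia_rule.simps by force
    from dia[OF five(2) this] show ?thesis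
      by (intro that[OF C]) (simp_all add: E(1) five(1))
  qed
qed

section \<open>Growing trees of unprovable sequents\<close>

definition open_tree :: "modal_axiom set \<Rightarrow> 'a tree \<Rightarrow> 'a nseq \<Rightarrow> bool" where
  "open_tree X F \<Gamma> \<longleftrightarrow> finite F \<and> F \<noteq> {} \<and> embeds F \<Gamma> \<and>
    \<not> provable (sys_K \<union> dia_rules X) \<Gamma> \<and> (\<forall>\<sigma> A. (\<sigma>, Some A) \<in> F \<longrightarrow> simple A)"

text \<open>Compound formulas never enter the tree, so a requirement counts as met when some
  decomposition of it is covered.\<close>

definition realised :: "'a tree \<Rightarrow> nat list \<Rightarrow> 'a nseq \<Rightarrow> bool" where
  "realised F \<tau> \<Sigma> \<longleftrightarrow> (\<exists>\<Sigma>'. refines \<Sigma>' \<Sigma> \<and> all_fm simple \<Sigma>' \<and> covers F \<tau> \<Sigma>')"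

lemma realised_mono: "realised F \<tau> \<Sigma> \<Longrightarrow> F \<subseteq> F' \<Longrightarrow> realised F' \<tau> \<Sigma>"
  unfolding realised_def using covers_mono by blast

lemma open_tree_start:
  assumes "\<not> provable (sys_K \<union> dia_rules X) \<Gamma>"
  obtains F \<Gamma>' where "open_tree X F \<Gamma>'" "realised F [] \<Gamma>"
proof -
  have "\<not> provable (sys_K \<union> dia_rules X) (fill (Hole {#}) \<Gamma>)" using assms by simp
  then obtain \<Gamma>' where \<Gamma>': "refines \<Gamma>' \<Gamma>" "all_fm simple \<Gamma>'"
    "\<not> provable (sys_K \<union> dia_rules X) \<Gamma>'"
    using simple_refinement[of "sys_K \<union> dia_rules X" "Hole {#}" \<Gamma>] by auto
  moreover obtain F where "represents 0 F \<Gamma>'" using representation_exists by blast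
  ultimately show ?thesis
    by (intro that[of F \<Gamma>']) (auto simp: represents_def open_tree_def realised_def)
qed

text \<open>The premise of a one-premise rule with unprovable conclusion is unprovable. Only its
  added part \<Sigma> is decomposed, and a representation of the result is grafted at
  \<tau>.\<close>

lemma open_tree_realise:
  assumes "open_tree X F \<Gamma>" "required X F \<tau> \<Sigma>"
  shows "\<exists>F' \<Gamma>'. F \<subseteq> F' \<and> open_tree X F' \<Gamma>' \<and> realised F' \<tau> \<Sigma>"
proof -
  let ?S = "sys_K \<union> dia_rules X"
  have emb: "embeds F \<Gamma>" using assms(1) by (simp add: open_tree_def)
  from required_rule[OF emb assms(2)] obtain C \<Pi>
    where C: "\<Gamma> = fill C \<Pi>" "located F \<tau> C \<Pi>" "([fill C (\<Pi> + \<Sigma>)], fill C \<Pi>) \<in> ?S" by blast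
  have "\<not> provable ?S (fill C (\<Pi> + \<Sigma>))"
    using provableI[OF C(3)] assms(1) by (auto simp: open_tree_def C(1))
  then obtain \<Sigma>' where \<Sigma>': "refines \<Sigma>' \<Sigma>" "all_fm simple \<Sigma>'" "\<not> provable ?S (fill C (\<Pi> + \<Sigma>'))"
    unfolding fill_union by (rule simple_refinement[rotated]) auto
  have fin: "finite (shift \<tau> F)"
  proof -
    have "shift \<tau> F = (\<lambda>(\<rho>, x). (\<tau> @ \<rho>, x)) -` F" by (auto simp: shift_def)
    moreover have "inj (\<lambda>(\<rho>, x). (\<tau> @ \<rho>, x))" by (auto simp: inj_def)
    ultimately show ?thesis using assms(1) by (auto simp: open_tree_def intro: finite_vimageI)
  qed
  \<comment> \<open>New child labels lie above the old ones: a clash would merge a new box with an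
    old one, and their joint content need not fit into any single box of the sequent.\<close>
  then obtain N where N: "\<forall>c. shift [c] (shift \<tau> F) \<noteq> {} \<longrightarrow> c < N" using finite_children by blast
  obtain G where G: "represents N G \<Sigma>'" using representation_exists by blast
  have "embeds (shift \<tau> F \<union> G) (\<Pi> + \<Sigma>')"
  proof (rule embeds_union)
    show "embeds (shift \<tau> F) \<Pi>" using C(2) by (simp add: located_def)
    show "embeds G \<Sigma>'" using G by (simp add: represents_def)
    show "shift [c] (shift \<tau> F) = {} \<or> shift [c] G = {}" for c
      using N G unfolding represents_def by (meson leD)
  qed
  then have "embeds (F \<union> graft \<tau> G) (fill C (\<Pi> + \<Sigma>'))"
    using C(2) leq_union unfolding located_def by blast
  moreover have "finite (graft \<tau> G)" using G by (simp add: represents_def graft_def)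
  moreover have "simple A" if "(\<sigma>, Some A) \<in> graft \<tau> G" for \<sigma> A
    using that G \<Sigma>'(2) by (fastforce simp: represents_def graft_def)
  ultimately have "open_tree X (F \<union> graft \<tau> G) (fill C (\<Pi> + \<Sigma>'))"
    using assms(1) \<Sigma>'(3) by (auto simp: open_tree_def)
  moreover have "realised (F \<union> graft \<tau> G) \<tau> \<Sigma>"
    using \<Sigma>' G covers_graft[of G \<Sigma>' \<tau> "F \<union> graft \<tau> G"]
    by (auto simp: realised_def represents_def)
  ultimately show ?thesis by blast
qed

text \<open>A requirement stays one as the tree grows, and once realised stays realised, so the
  finitely many requirements of \<open>F\<close> can be treated in any order. Those that newly arise
  wait for the next round.\<close>

lemma open_tree_round:
  assumes "open_tree X F \<Gamma>"
  shows "\<exists>F' \<Gamma>'. F \<subseteq> F' \<and> open_tree X F' \<Gamma>' \<and> (\<forall>\<tau> \<Sigma>. required X F \<tau> \<Sigma> \<longrightarrow> realised F' \<tau> \<Sigma>)"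
proof -
  have "\<exists>F' \<Gamma>'. F \<subseteq> F' \<and> open_tree X F' \<Gamma>' \<and> (\<forall>(\<tau>, \<Sigma>)\<in>T. realised F' \<tau> \<Sigma>)"
    if "finite T" "T \<subseteq> {(\<tau>, \<Sigma>). required X F \<tau> \<Sigma>}" for T
    using that
  proof (induction T)
    case empty
    then show ?case using assms by blast
  next
    case (insert i T)
    then obtain F1 \<Gamma>1 where F1: "F \<subseteq> F1" "open_tree X F1 \<Gamma>1" "\<forall>(\<tau>, \<Sigma>)\<in>T. realised F1 \<tau> \<Sigma>" by auto
    obtain \<tau> \<Sigma> where i: "i = (\<tau>, \<Sigma>)" "required X F1 \<tau> \<Sigma>"
      using insert.prems required_mono[OF _ F1(1)] by (cases i) auto
    from open_tree_realise[OF F1(2) i(2)] obtain F2 \<Gamma>2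
      where "F1 \<subseteq> F2" "open_tree X F2 \<Gamma>2" "realised F2 \<tau> \<Sigma>" by blast
    then show ?case
      using F1 i(1) realised_mono[of F1 _ _ F2] by (intro exI[of _ F2] exI[of _ \<Gamma>2]) auto
  qed
  from this[OF finite_required[where F = F and X = X]] show ?thesis using assms by (auto simp: open_tree_def)
qed

lemma saturated_tree:
  assumes "\<not> provable (sys_K \<union> dia_rules X) \<Gamma>"
  obtains F where "F \<noteq> {}" "realised F [] \<Gamma>"
    "\<And>\<tau> \<Sigma>. required X F \<tau> \<Sigma> \<Longrightarrow> realised F \<tau> \<Sigma>"
    "\<And>\<sigma> p. (\<sigma>, Some (Atom p)) \<in> F \<Longrightarrow> (\<sigma>, Some (NAtom p)) \<notin> F"
proof -
  obtain F0 \<Gamma>0 where F0: "open_tree X F0 \<Gamma>0" "realised F0 [] \<Gamma>"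
    using open_tree_start[OF assms] by blast
  have "\<exists>f. \<forall>n. (open_tree X (fst (f n)) (snd (f n)) \<and> realised (fst (f n)) [] \<Gamma>) \<and>
    (fst (f n) \<subseteq> fst (f (Suc n)) \<and>
      (\<forall>\<tau> \<Sigma>. required X (fst (f n)) \<tau> \<Sigma> \<longrightarrow> realised (fst (f (Suc n))) \<tau> \<Sigma>))"
  proof (rule dependent_nat_choice)
    show "\<exists>x. open_tree X (fst x) (snd x) \<and> realised (fst x) [] \<Gamma>"
      using F0 by (intro exI[of _ "(F0, \<Gamma>0)"]) simp
    show "\<exists>y. (open_tree X (fst y) (snd y) \<and> realised (fst y) [] \<Gamma>) \<and> fst x \<subseteq> fst y \<and>
        (\<forall>\<tau> \<Sigma>. required X (fst x) \<tau> \<Sigma> \<longrightarrow> realised (fst y) \<tau> \<Sigma>)"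
      if x: "open_tree X (fst x) (snd x) \<and> realised (fst x) [] \<Gamma>" for x
    proof -
      from x open_tree_round[of X "fst x" "snd x"] obtain F' \<Gamma>' where "fst x \<subseteq> F'" "open_tree X F' \<Gamma>'"
        "\<forall>\<tau> \<Sigma>. required X (fst x) \<tau> \<Sigma> \<longrightarrow> realised F' \<tau> \<Sigma>" by blast
      then show ?thesis
        using x realised_mono[of "fst x" "[]" \<Gamma> F'] by (intro exI[of _ "(F', \<Gamma>')"]) simp
    qed
  qed
  then obtain f where f: "\<And>n. open_tree X (fst (f n)) (snd (f n))" "\<And>n. realised (fst (f n)) [] \<Gamma>"
    "\<And>n. fst (f n) \<subseteq> fst (f (Suc n))"
    "\<And>n \<tau> \<Sigma>. required X (fst (f n)) \<tau> \<Sigma> \<Longrightarrow> realised (fst (f (Suc n))) \<tau> \<Sigma>" by blast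
  define F where "F = (\<Union>n. fst (f n))"
  have sub: "fst (f n) \<subseteq> F" for n by (auto simp: F_def)
  have mono: "fst (f m) \<subseteq> fst (f n)" if "m \<le> n" for m n
    using f(3) that by (rule lift_Suc_mono_le)
  have pair: "\<exists>n. x \<in> fst (f n) \<and> y \<in> fst (f n)" if "x \<in> F" "y \<in> F" for x y
  proof -
    obtain m n where "x \<in> fst (f m)" "y \<in> fst (f n)"
      using \<open>x \<in> F\<close> \<open>y \<in> F\<close> by (auto simp: F_def)
    then show ?thesis using mono[of m "max m n"] mono[of n "max m n"] by auto
  qed
  have nodepair: "\<exists>n. x \<in> fst (f n) \<and> node (fst (f n)) \<sigma>" if "x \<in> F" "node F \<sigma>" for x \<sigma>
    using that pair unfolding node_iff by meson
  show ?thesis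
  proof (rule that)
    show "F \<noteq> {}" using f(1) sub[of 0] by (auto simp: open_tree_def)
    show "realised F [] \<Gamma>" using f(2) sub realised_mono by blast
    show "realised F \<tau> \<Sigma>" if "required X F \<tau> \<Sigma>" for \<tau> \<Sigma>
    proof -
      \<comment> \<open>A requirement rests on at most one entry and one node, which appear together
        at some stage; the next stage realises it.\<close>
      have "\<exists>n. required X (fst (f n)) \<tau> \<Sigma>"
        using that by cases (use pair nodepair in \<open>blast intro: required.intros\<close>)+
      then show ?thesis using f(4) sub realised_mono by blast
    qed
    show "(\<sigma>, Some (NAtom p)) \<notin> F" if A: "(\<sigma>, Some (Atom p)) \<in> F" for \<sigma> p
    proof
      assume "(\<sigma>, Some (NAtom p)) \<in> F"
      with A pair obtain n where n: "(\<sigma>, Some (Atom p)) \<in> fst (f n)" "(\<sigma>, Some (NAtom p)) \<in> fst (f n)"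
        by blast
      have "embeds (fst (f n)) (snd (f n))" using f(1) by (simp add: open_tree_def)
      from locate[OF this node_entry[OF n(1)]] obtain C \<Pi>
        where C: "snd (f n) = fill C \<Pi>" "located (fst (f n)) \<sigma> C \<Pi>" by blast
      obtain \<Pi>' where "\<Pi> = add_mset (Fm (Atom p)) \<Pi>'" "Fm (NAtom p) \<in># \<Pi>"
        using located_Fm[OF C(2)] n by (blast dest: multi_member_split)
      then obtain \<Pi>'' where "\<Pi> = \<Pi>'' + {#Fm (Atom p), Fm (NAtom p)#}"
        by (auto dest!: multi_member_split)
      then have "snd (f n) = fill (ctx_comp C (Hole \<Pi>'')) {#Fm (Atom p), Fm (NAtom p)#}" using C by simp
      then have "([], snd (f n)) \<in> ax_rule" unfolding ax_rule_def by blast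
      then have "provable (sys_K \<union> dia_rules X) (snd (f n))"
        by (intro provableI[where Ps = "[]"]) (auto simp: sys_K_def)
      then show False using f(1) by (auto simp: open_tree_def)
    qed
  qed
qed

section \<open>The countermodel\<close>

text \<open>A refuted box only needs a suitable successor, and the child that covers it is one, so
  it suffices that \<open>R\<close> extends the child relation.\<close>

lemma covers_refutes:
  assumes child: "\<And>\<sigma> c. node F (\<sigma> @ [c]) \<Longrightarrow> (\<sigma>, \<sigma> @ [c]) \<in> R"
  shows "covers F \<sigma> \<Sigma> \<Longrightarrow>
    all_fm (\<lambda>A. \<forall>\<sigma>. (\<sigma>, Some A) \<in> F \<longrightarrow> \<not> holds R V \<sigma> A) \<Sigma> \<Longrightarrow> refutes R V \<sigma> \<Sigma>"
proof -
  have "refutes_item R V i \<sigma>" if "covers_item F i \<sigma>"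
    "all_fm_item (\<lambda>A. \<forall>\<sigma>. (\<sigma>, Some A) \<in> F \<longrightarrow> \<not> holds R V \<sigma> A) i" for i
    using that
  proof (induction i arbitrary: \<sigma>)
    case (Br \<Delta>)
    then obtain c where c: "node F (\<sigma> @ [c])" "covers F (\<sigma> @ [c]) \<Delta>" by auto
    have "refutes R V (\<sigma> @ [c]) \<Delta>"
      using c(2) Br by (auto simp: covers_def refutes_def)
    then show ?case using child[OF c(1)] by (auto simp: refutes_def)
  qed auto
  then show "covers F \<sigma> \<Sigma> \<Longrightarrow>
    all_fm (\<lambda>A. \<forall>\<sigma>. (\<sigma>, Some A) \<in> F \<longrightarrow> \<not> holds R V \<sigma> A) \<Sigma> \<Longrightarrow> refutes R V \<sigma> \<Sigma>"
    by (auto simp: covers_def refutes_def all_fm_def)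
qed

theorem completeness:
  assumes "closed45 X" "\<not> provable (sys_K \<union> dia_rules X) \<Gamma>"
  obtains W and R :: "(nat list \<times> nat list) set" and V w
  where "frame W R" "\<forall>\<rho>\<in>X. frame_cond \<rho> W R" "w \<in> W" "refutes R V w \<Gamma>"
proof -
  obtain F where F: "F \<noteq> {}" "realised F [] \<Gamma>"
    "\<And>\<tau> \<Sigma>. required X F \<tau> \<Sigma> \<Longrightarrow> realised F \<tau> \<Sigma>"
    "\<And>\<sigma> p. (\<sigma>, Some (Atom p)) \<in> F \<Longrightarrow> (\<sigma>, Some (NAtom p)) \<notin> F"
    using saturated_tree[OF assms(2)] by blast
  define Q where "Q \<sigma> A \<longleftrightarrow> (\<sigma>, Some (Dia A)) \<in> F" for \<sigma> A
  \<comment> \<open>By the third clause of \<open>refines\<close> a simple formula survives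
    decomposition; for \<open>succ\<close> below, the fourth clause preserves the presence of some
    box.\<close>
  have dia: "Q \<tau> A" if "required X F \<tau> {#Fm (Dia A)#}" for \<tau> A
  proof -
    from F(3)[OF that] obtain \<Sigma> where "refines \<Sigma> {#Fm (Dia A)#}" "covers F \<tau> \<Sigma>"
      by (auto simp: realised_def)
    moreover from this(1) have "Fm (Dia A) \<in># \<Sigma>" by (auto simp: refines_def)
    ultimately show ?thesis by (fastforce simp: covers_def Q_def)
  qed
  have succ: "\<exists>c. node F (\<tau> @ [c])" if "required X F \<tau> {#Br {#Fm A#}#}" for \<tau> A
  proof -
    from F(3)[OF that] obtain \<Sigma> where "refines \<Sigma> {#Br {#Fm A#}#}" "covers F \<tau> \<Sigma>"
      by (auto simp: realised_def)
    moreover from this(1) obtain \<Delta> where "Br \<Delta> \<in># \<Sigma>" by (auto simp: refines_def)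
    ultimately show ?thesis by (fastforce simp: covers_def)
  qed
  have root: "[] \<in> {\<sigma>. node F \<sigma>}" using F(1) by (auto simp: node_def)
  obtain R where R: "frame {\<sigma>. node F \<sigma>} R" "\<forall>\<rho>\<in>X. frame_cond \<rho> {\<sigma>. node F \<sigma>} R"
    "\<And>\<sigma> c. node F (\<sigma> @ [c]) \<Longrightarrow> (\<sigma>, \<sigma> @ [c]) \<in> R"
    "\<And>\<sigma> \<tau> A. (\<sigma>, \<tau>) \<in> R \<Longrightarrow> Q \<sigma> A \<Longrightarrow> realised F \<tau> {#Fm A#}"
  proof (rule tree_frame[OF assms(1) root, of Q "\<lambda>\<tau> A. realised F \<tau> {#Fm A#}"])
    fix \<sigma> \<tau> :: "nat list" and c :: nat and A :: "'a fm"
    show "\<sigma> \<in> {\<sigma>. node F \<sigma>}" if "\<sigma> @ [c] \<in> {\<sigma>. node F \<sigma>}" using that node_prefix by auto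
    show "realised F (\<sigma> @ [c]) {#Fm A#}" if "\<sigma> @ [c] \<in> {\<sigma>. node F \<sigma>}" "Q \<sigma> A"
      using that F(3)[OF required.k[of \<sigma> A F c]] by (simp add: Q_def)
    show "\<exists>c. \<sigma> @ [c] \<in> {\<sigma>. node F \<sigma>}" if "AxD \<in> X" "Q \<sigma> A"
      using that succ[OF required.d[of X \<sigma> A F]] by (simp add: Q_def)
    show "realised F \<sigma> {#Fm A#}" if "AxT \<in> X" "Q \<sigma> A"
      using that F(3)[OF required.t[of X \<sigma> A F]] by (simp add: Q_def)
    show "realised F \<sigma> {#Fm A#}" if "AxB \<in> X" "Q (\<sigma> @ [c]) A"
      using that F(3)[OF required.b[of X \<sigma> c A F]] by (simp add: Q_def)
    show "Q (\<sigma> @ [c]) A" if "Ax4 \<in> X" "\<sigma> @ [c] \<in> {\<sigma>. node F \<sigma>}" "Q \<sigma> A"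
      using that dia[OF required.four[of X \<sigma> A F c]] by (simp add: Q_def)
    show "Q \<tau> A" if "Ax5 \<in> X" "\<sigma> \<noteq> []" "\<tau> \<in> {\<sigma>. node F \<sigma>}" "Q \<sigma> A"
      using that dia[OF required.five[of X \<sigma> A F \<tau>]] by (simp add: Q_def)
  qed (rule that; simp)
  \<comment> \<open>Atoms are false exactly where they occur; a negated atom is then refuted because
    its atom does not occur at the same node.\<close>
  define V where "V \<sigma> p \<longleftrightarrow> (\<sigma>, Some (Atom p)) \<notin> F" for \<sigma> p
  have false: "\<not> holds R V \<sigma> A" if "simple A" "(\<sigma>, Some A) \<in> F" for \<sigma> A
    using that
  \<comment> \<open>The body of a diamond may be compound and is replaced by its decomposition,
    whose formulas are bounded in size; hence induction on size.\<close>
  proof (induction "size A" arbitrary: \<sigma> A rule: less_induct)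
    case less
    show ?case
    proof (cases A)
      case (Dia B)
      have "\<not> holds R V \<tau> B" if \<tau>: "(\<sigma>, \<tau>) \<in> R" for \<tau>
      proof -
        obtain \<Sigma> where \<Sigma>: "refines \<Sigma> {#Fm B#}" "all_fm simple \<Sigma>" "covers F \<tau> \<Sigma>"
          using R(4)[OF \<tau>, of B] less.prems Dia by (auto simp: realised_def Q_def)
        then have "all_fm (\<lambda>A. size A \<le> size B) \<Sigma>" by (simp add: refines_def)
        then have "all_fm (\<lambda>A. \<forall>\<sigma>. (\<sigma>, Some A) \<in> F \<longrightarrow> \<not> holds R V \<sigma> A) \<Sigma>"
          using all_fm_mono[OF all_fm_conj[OF \<Sigma>(2)]] less.hyps Dia by fastforce
        then have "refutes R V \<tau> \<Sigma>" using covers_refutes[OF R(3) \<Sigma>(3)] by blast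
        then show ?thesis using \<Sigma>(1) by (simp add: refines_def)
      qed
      then show ?thesis using Dia by simp
    qed (use less.prems F(4) in \<open>auto simp: V_def\<close>)
  qed
  obtain \<Sigma> where \<Sigma>: "refines \<Sigma> \<Gamma>" "all_fm simple \<Sigma>" "covers F [] \<Sigma>"
    using F(2) by (auto simp: realised_def)
  have "all_fm (\<lambda>A. \<forall>\<sigma>. (\<sigma>, Some A) \<in> F \<longrightarrow> \<not> holds R V \<sigma> A) \<Sigma>"
    using \<Sigma>(2) by (rule all_fm_mono) (use false in blast)
  then have "refutes R V [] \<Sigma>" using covers_refutes[OF R(3) \<Sigma>(3)] by blast
  then have "refutes R V [] \<Gamma>" using \<Sigma>(1) by (simp add: refines_def)
  then show ?thesis using that[OF R(1,2) root] by blast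
qed

theorem theorem2p35:
  fixes X :: "modal_axiom set" and \<Gamma> :: "'a nseq"
  assumes "closed45 X"
    and "provable (sys_K \<union> dia_rules X \<union> cut_rule) \<Gamma>"
  shows "provable (sys_K \<union> dia_rules X) \<Gamma>"
  using completeness[OF assms(1)] soundness[OF assms(2)] by metis

end
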